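(* Let $0<\gamma<2$ and let $F:\mathcal S_N\to\mathbb R$ be a continuous, uniformly elliptic, rotationally invariant and positively $1$-homogeneous operator (see context). Then: (i) $\bar\lambda_\gamma>0$, and there exists a radial function $u$, continuous in $\overline{B(0,1)}$ and strictly positive in $B(0,1)$, such that $$F(D^2u)+\bar\lambda_\gamma\frac{u}{r^\gamma}=0\ \text{ in } B(0,1)\setminus\{0\},\qquad u=0\ \text{ on }\partial B(0,1).$$ Furthermore $u$ is of class $C^2(B(0,1)\setminus\{0\})$, and on $B(0,1)$ it is (i.e. extends as) a Lipschitz continuous function if $\gamma\le 1$, a function of class $C^1(B(0,1))$ if $\gamma<1$, and a Hölder continuous function with exponent $2-\gamma$ if $\gamma>1$. (ii) $\bar\lambda_\gamma$ is stable under the following approximations: $$\bar\lambda_\gamma=\lim_{\epsilon\to0}\bar\lambda\Big(F,\frac{1}{(r^2+\epsilon^2)^{\gamma/2}},B(0,1)\Big),\qquad \bar\lambda_\gamma=\lim_{\delta\to0}\bar\lambda\Big(F,\frac1{r^\gamma},B(0,1)\setminus\overline{B(0,\delta)}\Big).$$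
   Context: $B(0,t)$ is the open ball of radius $t$ centered at $0$ in $\mathbb R^N$, $r=|x|$, and $\mathcal S_N$ is the set of symmetric $N\times N$ matrices. Constants $\Lambda\ge\lambda>0$ are fixed. The operator $F$ is continuous on $\mathcal S_N$ and satisfies: $\lambda\,\mathrm{tr}(M')\le F(M+M')-F(M)\le\Lambda\,\mathrm{tr}(M')$ for all $M,M'\in\mathcal S_N$ with $M'$ positive semidefinite (uniform ellipticity); $F(O^tMO)=F(M)$ for all orthogonal $O$ and all $M\in\mathcal S_N$ (rotational invariance); $F(tM)=tF(M)$ for all $t>0$, $M\in\mathcal S_N$ (positive homogeneity). Standing assumption: $\tilde N_+>2$, where $\tilde N_+=\frac{\lambda}{\Lambda}(N-1)+1$. For a domain $\Omega$ and a positive continuous potential $f$ on $\Omega$, $$\bar\lambda(F,f,\Omega)=\sup\{\mu:\ \exists\,u\in C(\Omega),\ u>0\text{ in }\Omega,\ F(D^2u)+\mu f u\le0\text{ in }\Omega\},$$ the inequality being in the viscosity sense, and $$\bar\lambda_\gamma=\bar\lambda(F,r^{-\gamma},B(0,1)\setminus\{0\}).$$ *)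

theory Defs
  imports "HOL-Analysis.Analysis"
begin

definition sym_matrices :: "(real^'n^'n) set" where
  "sym_matrices = {M. transpose M = M}"

definition pos_semidef :: "real^'n^'n \<Rightarrow> bool" where
  "pos_semidef M \<longleftrightarrow> M \<in> sym_matrices \<and> (\<forall>x. 0 \<le> x \<bullet> (M *v x))"

(* An operator is a total function on matrices, but every condition on it
   concerns symmetric matrices only. *)

definition uniformly_elliptic :: "real \<Rightarrow> real \<Rightarrow> (real^'n^'n \<Rightarrow> real) \<Rightarrow> bool" where
  "uniformly_elliptic lam Lam F \<longleftrightarrow>
     (\<forall>M\<in>sym_matrices. \<forall>M'. pos_semidef M' \<longrightarrow>
        lam * trace M' \<le> F (M + M') - F M \<and> F (M + M') - F M \<le> Lam * trace M')"

definition rotationally_invariant :: "(real^'n^'n \<Rightarrow> real) \<Rightarrow> bool" where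
  "rotationally_invariant F \<longleftrightarrow>
     (\<forall>Q. \<forall>M\<in>sym_matrices. orthogonal_matrix Q \<longrightarrow> F (transpose Q ** M ** Q) = F M)"

definition positively_homogeneous :: "(real^'n^'n \<Rightarrow> real) \<Rightarrow> bool" where
  "positively_homogeneous F \<longleftrightarrow> (\<forall>t>0. \<forall>M\<in>sym_matrices. F (t *\<^sub>R M) = t * F M)"

definition C1_on :: "(real^'n) set \<Rightarrow> (real^'n \<Rightarrow> real) \<Rightarrow> bool" where
  "C1_on U u \<longleftrightarrow> (\<exists>g. (\<forall>x\<in>U. GDERIV u x :> (g x)) \<and> continuous_on U g)"

(* On an open set U, phi is of class C^2 with gradient g and Hessian H.  Symmetry of H is not
   required: it is automatic because H is continuous. *)
definition has_C2_hessian_on ::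
  "(real^'n) set \<Rightarrow> (real^'n \<Rightarrow> real) \<Rightarrow> (real^'n \<Rightarrow> real^'n) \<Rightarrow> (real^'n \<Rightarrow> real^'n^'n) \<Rightarrow> bool" where
  "has_C2_hessian_on U \<phi> g H \<longleftrightarrow>
     (\<forall>x\<in>U. GDERIV \<phi> x :> (g x)) \<and>
     (\<forall>x\<in>U. (g has_derivative (\<lambda>h. H x *v h)) (at x)) \<and>
     continuous_on U H"

definition C2_on :: "(real^'n) set \<Rightarrow> (real^'n \<Rightarrow> real) \<Rightarrow> bool" where
  "C2_on U u \<longleftrightarrow> (\<exists>g H. has_C2_hessian_on U u g H)"

definition holder_on :: "real \<Rightarrow> 'a::metric_space set \<Rightarrow> ('a \<Rightarrow> real) \<Rightarrow> bool" where
  "holder_on \<alpha> S u \<longleftrightarrow> (\<exists>C. \<forall>x\<in>S. \<forall>y\<in>S. \<bar>u x - u y\<bar> \<le> C * dist x y powr \<alpha>)"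

(* F(D^2 u) + V u \<le> 0 in the viscosity sense: phi is a C^2 test function on a neighbourhood W
   of x0 such that u - phi has a minimum over W at x0. *)
definition viscosity_supersolution ::
  "(real^'n^'n \<Rightarrow> real) \<Rightarrow> (real^'n \<Rightarrow> real) \<Rightarrow> (real^'n) set \<Rightarrow> (real^'n \<Rightarrow> real) \<Rightarrow> bool" where
  "viscosity_supersolution F V \<Omega> u \<longleftrightarrow>
     (\<forall>x0 W \<phi> g H. open W \<longrightarrow> x0 \<in> W \<longrightarrow> W \<subseteq> \<Omega> \<longrightarrow> has_C2_hessian_on W \<phi> g H \<longrightarrow>
        (\<forall>x\<in>W. u x0 - \<phi> x0 \<le> u x - \<phi> x) \<longrightarrow> F (H x0) + V x0 * u x0 \<le> 0)"

(* F(D^2 u) + V u \<ge> 0 in the viscosity sense *)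
definition viscosity_subsolution ::
  "(real^'n^'n \<Rightarrow> real) \<Rightarrow> (real^'n \<Rightarrow> real) \<Rightarrow> (real^'n) set \<Rightarrow> (real^'n \<Rightarrow> real) \<Rightarrow> bool" where
  "viscosity_subsolution F V \<Omega> u \<longleftrightarrow>
     (\<forall>x0 W \<phi> g H. open W \<longrightarrow> x0 \<in> W \<longrightarrow> W \<subseteq> \<Omega> \<longrightarrow> has_C2_hessian_on W \<phi> g H \<longrightarrow>
        (\<forall>x\<in>W. u x - \<phi> x \<le> u x0 - \<phi> x0) \<longrightarrow> F (H x0) + V x0 * u x0 \<ge> 0)"

definition viscosity_solution ::
  "(real^'n^'n \<Rightarrow> real) \<Rightarrow> (real^'n \<Rightarrow> real) \<Rightarrow> (real^'n) set \<Rightarrow> (real^'n \<Rightarrow> real) \<Rightarrow> bool" where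
  "viscosity_solution F V \<Omega> u \<longleftrightarrow>
     continuous_on \<Omega> u \<and> viscosity_supersolution F V \<Omega> u \<and> viscosity_subsolution F V \<Omega> u"

(* Extended-real valued, so that the supremum is meaningful without assuming boundedness. *)
definition principal_eigenvalue ::
  "(real^'n^'n \<Rightarrow> real) \<Rightarrow> (real^'n \<Rightarrow> real) \<Rightarrow> (real^'n) set \<Rightarrow> ereal" where
  "principal_eigenvalue F f \<Omega> =
     Sup (ereal ` {\<mu>. \<exists>u. continuous_on \<Omega> u \<and> (\<forall>x\<in>\<Omega>. u x > 0) \<and>
                        viscosity_supersolution F (\<lambda>x. \<mu> * f x) \<Omega> u})"

definition singular_eigenvalue :: "(real^'n^'n \<Rightarrow> real) \<Rightarrow> real \<Rightarrow> ereal" where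
  "singular_eigenvalue F \<gamma> = principal_eigenvalue F (\<lambda>x. norm x powr (- \<gamma>)) (ball 0 1 - {0})"

end

theory Submission
  imports Defs "HOL-Analysis.Analysis"
begin

text \<open>On radial functions \<open>u(x) = p(r)\<close> the operator reduces to \<open>Phi (p'') (p' / r)\<close> for a
  positively homogeneous function \<open>Phi\<close> that is increasing in both arguments, with slopes
  controlled by the ellipticity constants. Substituting \<open>s = r powr (2 - \<gamma>)\<close> turns the equation
  with potential \<open>r powr (- \<gamma>)\<close> into a first-order system with a singular point at \<open>s = 0\<close>, which
  is dissipative there precisely because \<open>\<lambda>/\<Lambda> (N - 1) > 1\<close>; Banach's theorem gives a global
  solution, a Riccati inequality shows that it vanishes somewhere, and by scaling its first zero
  is the eigenvalue \<open>\<mu>\<close>. The regularity of \<open>u\<close> is that of \<open>r powr (2 - \<gamma>)\<close>, since the solution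
  is \<open>C\<^sup>1\<close> in \<open>s\<close>.

  The function \<open>u\<close> is itself a positive supersolution, also across the origin, because no \<open>C\<^sup>2\<close>
  function touches it from below there. Conversely, for every \<open>\<mu>' > \<mu>\<close> a small perturbation of
  \<open>u\<close> is a strict subsolution that is positive only inside a compact annulus of the punctured
  ball. Its multiples are test functions for every positive supersolution, which bounds the
  eigenvalues of all the approximating problems by \<open>\<mu>'\<close> at once.\<close>

text \<open>The obstacle is the coefficient 1/s at s = 0 together with a nonlinearity
  \<open>G\<close> known only to be Lipschitz: Picard iteration on s y' + y = (y + G) / b need not
  contract. Since \<open>G\<close> falls in y at rates between lam n / Lam and Lam n / lam, adding k
  y to both sides makes the right side nondecreasing in y for large k, with Lipschitz constant (1 +
  k b - lam n / Lam) / b. The inverse of s d/ds + k + 1 is an average of norm 1 / (k + 1), so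
  contraction in y asks for 1 - lam n / Lam < b: k cancels, and lam n > Lam covers every b = 2 -
  \<gamma> > 0. On the upper bound: a competing supersolution may blow up at the origin or
  degenerate at the outer boundary. Because the barrier is nonpositive at both ends of a compact
  annulus, its ratio to the competitor is maximised at an interior point, so no comparison principle
  for the singular potential and no boundary information about the competitor enters.\<close>

section \<open>A singular first-order system\<close>

text \<open>The solution, bounded at 0, of s m' + (k + 1) m = f, that is, s^(-k-1) times the
  integral of \<sigma>^k f(\<sigma>) over (0, s). Rescaled to {0..1} it also makes sense at the
  singular point s = 0. For k = 0, s times this mean is the plain antiderivative.\<close>

definition moment_mean :: "nat \<Rightarrow> (real \<Rightarrow> real) \<Rightarrow> real \<Rightarrow> real" where
  "moment_mean k f s = integral {0..1} (\<lambda>\<tau>. \<tau> ^ k * f (s * \<tau>))"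

lemma moment_mean_integrable:
  fixes f :: "real \<Rightarrow> real"
  assumes "continuous_on UNIV f"
  shows "(\<lambda>\<tau>. \<tau> ^ k * f (s * \<tau>)) integrable_on {0..1}"
  by (rule integrable_continuous_real)
    (intro continuous_intros continuous_on_compose2[OF assms], auto)

lemma continuous_moment_mean:
  assumes "continuous_on UNIV f"
  shows "continuous_on UNIV (moment_mean k f)"
proof -
  have "continuous_on (UNIV \<times> cbox 0 1) (\<lambda>(s, \<tau>). \<tau> ^ k * f (s * \<tau>))"
    unfolding case_prod_unfold
    by (intro continuous_intros continuous_on_compose2[OF assms]) auto
  from integral_continuous_on_param[OF this] show ?thesis
    by (simp add: moment_mean_def[abs_def])
qed

lemma moment_mean_0:
  "moment_mean k f 0 = f 0 / (real k + 1)"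
proof -
  have "((\<lambda>\<tau>::real. \<tau> ^ k) has_integral 1 ^ Suc k / (real k + 1) - 0 ^ Suc k / (real k + 1)) {0..1}"
    by (intro fundamental_theorem_of_calculus)
      (auto simp: has_real_derivative_iff_has_vector_derivative[symmetric] add.commute
        add_nonneg_eq_0_iff intro!: derivative_eq_intros simp del: power_Suc)
  then have "((\<lambda>\<tau>::real. \<tau> ^ k) has_integral 1 / (real k + 1)) {0..1}" by simp
  from has_integral_mult_left[OF this, of "f 0"]
  have "((\<lambda>\<tau>. \<tau> ^ k * f (0 * \<tau>)) has_integral f 0 / (real k + 1)) {0..1}" by simp
  then show ?thesis unfolding moment_mean_def by (rule integral_unique)
qed

lemma moment_mean_eq_integral:
  assumes "continuous_on UNIV f" "0 < s"
  shows "s ^ Suc k * moment_mean k f s = integral {0..s} (\<lambda>\<sigma>. \<sigma> ^ k * f \<sigma>)"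
proof -
  have "(\<lambda>\<sigma>. \<sigma> ^ k * f \<sigma>) integrable_on {0..s}"
    by (intro integrable_continuous_real continuous_intros continuous_on_subset[OF assms(1)]) auto
  then have I: "((\<lambda>\<sigma>. \<sigma> ^ k * f \<sigma>) has_integral integral {0..s} (\<lambda>\<sigma>. \<sigma> ^ k * f \<sigma>)) {0..s}"
    by (rule integrable_integral)
  have im: "(\<lambda>x. x / s) ` {0..s} = {0..1}"
    using assms(2) by (auto simp: image_iff divide_simps intro!: bexI[of _ "_ * s"])
  have "((\<lambda>\<tau>. (s * \<tau>) ^ k * f (s * \<tau>)) has_integral
      integral {0..s} (\<lambda>\<sigma>. \<sigma> ^ k * f \<sigma>) / s) {0..1}"
    using has_integral_stretch_real[OF I, of s] assms(2) im
    by (simp add: divide_inverse mult.commute)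
  then have "integral {0..1} (\<lambda>\<tau>. s ^ k * (\<tau> ^ k * f (s * \<tau>))) =
      integral {0..s} (\<lambda>\<sigma>. \<sigma> ^ k * f \<sigma>) / s"
    by (intro integral_unique) (simp add: power_mult_distrib mult.assoc)
  then have "s ^ k * moment_mean k f s = integral {0..s} (\<lambda>\<sigma>. \<sigma> ^ k * f \<sigma>) / s"
    by (simp add: moment_mean_def)
  then show ?thesis
    using assms(2) by (simp add: nonzero_eq_divide_eq mult_ac)
qed

lemma moment_mean_power_deriv:
  assumes "continuous_on UNIV f" "0 < s"
  shows "((\<lambda>s. s ^ Suc k * moment_mean k f s) has_real_derivative s ^ k * f s) (at s)"
proof -
  have c: "continuous_on {0..s + 1} (\<lambda>\<sigma>. \<sigma> ^ k * f \<sigma>)"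
    by (intro continuous_intros continuous_on_subset[OF assms(1)]) auto
  have "((\<lambda>s. integral {0..s} (\<lambda>\<sigma>. \<sigma> ^ k * f \<sigma>)) has_real_derivative s ^ k * f s)
      (at s within {0..s + 1})"
    using assms(2) by (intro integral_has_real_derivative[OF c]) auto
  then have "((\<lambda>s. integral {0..s} (\<lambda>\<sigma>. \<sigma> ^ k * f \<sigma>)) has_real_derivative s ^ k * f s)
      (at s within {0<..<s + 1})"
    by (rule DERIV_subset) auto
  then have "((\<lambda>s. s ^ Suc k * moment_mean k f s) has_real_derivative s ^ k * f s)
      (at s within {0<..<s + 1})"
    by (rule has_field_derivative_transform_within[where d=s])
       (use assms in \<open>auto simp: moment_mean_eq_integral simp del: power_Suc\<close>)
  then show ?thesis
    using assms(2) by (simp add: at_within_open[of s "{0<..<s + 1}"] del: power_Suc)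
qed

text \<open>The weight is the Bielecki weight that makes the Picard operator of
  \<open>singular_ode_fixpoint\<close> a contraction on the whole half line.\<close>
lemma moment_mean_exp_bound:
  assumes f: "continuous_on UNIV f" and s: "0 \<le> s" and B: "0 \<le> B"
    and D: "\<And>x. 0 \<le> x \<Longrightarrow> x \<le> s \<Longrightarrow> \<bar>f x\<bar> \<le> D * exp (B * x)"
  shows "\<bar>moment_mean k f s\<bar> \<le> D * exp (B * s) / (real k + 1)"
proof -
  have "\<bar>moment_mean k f s\<bar> \<le> integral {0..1} (\<lambda>\<tau>. \<tau> ^ k * (D * exp (B * s)))"
    unfolding moment_mean_def real_norm_def[symmetric]
  proof (rule integral_norm_bound_integral)
    show "(\<lambda>\<tau>. \<tau> ^ k * (D * exp (B * s))) integrable_on {0..1}"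
      by (intro integrable_continuous_real continuous_intros)
    fix \<tau> :: real assume t: "\<tau> \<in> {0..1}"
    have D0: "0 \<le> D" using D[of 0] s by auto
    have "s * \<tau> \<le> s" using t s mult_left_le by auto
    then have "\<bar>f (s * \<tau>)\<bar> \<le> D * exp (B * (s * \<tau>))" using t s by (intro D) auto
    also have "\<dots> \<le> D * exp (B * s)"
      using \<open>s * \<tau> \<le> s\<close> B D0 by (intro mult_left_mono) (auto intro: mult_left_mono)
    finally show "norm (\<tau> ^ k * f (s * \<tau>)) \<le> \<tau> ^ k * (D * exp (B * s))"
      using t by (auto simp: abs_mult intro!: mult_left_mono)
  qed (rule moment_mean_integrable[OF f])
  also have "\<dots> = moment_mean k (\<lambda>_. D * exp (B * s)) 0" by (simp add: moment_mean_def)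
  finally show ?thesis by (simp only: moment_mean_0)
qed

lemma moment_mean_diff:
  assumes "continuous_on UNIV f" "continuous_on UNIV g"
  shows "moment_mean k f s - moment_mean k g s = moment_mean k (\<lambda>x. f x - g x) s"
  unfolding moment_mean_def
  using integral_diff[OF moment_mean_integrable[OF assms(1)] moment_mean_integrable[OF assms(2)]]
  by (simp add: right_diff_distrib)

text \<open>A true integration gains 1 / B, whereas the average in
  \<open>moment_mean_exp_bound\<close> gains only 1 / (k + 1) whatever B is. A large B therefore
  absorbs the dependence on v, but not the one on y.\<close>

lemma integral_exp_bound:
  assumes f: "continuous_on UNIV f" and s: "0 \<le> s" and B: "0 < B"
    and D: "\<And>x. 0 \<le> x \<Longrightarrow> \<bar>f x\<bar> \<le> D * exp (B * x)"
  shows "\<bar>s * moment_mean 0 f s\<bar> \<le> D * exp (B * s) / B"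
proof (cases "s = 0")
  case True
  then show ?thesis using D[of 0] B by auto
next
  case False
  then have "0 < s" using s by simp
  have I: "((\<lambda>x. D * exp (B * x)) has_integral D * exp (B * s) / B - D * exp (B * 0) / B) {0..s}"
    using s B by (intro fundamental_theorem_of_calculus)
      (auto simp: has_real_derivative_iff_has_vector_derivative[symmetric]
        intro!: derivative_eq_intros)
  have "\<bar>s * moment_mean 0 f s\<bar> = \<bar>integral {0..s} f\<bar>"
    using moment_mean_eq_integral[OF f \<open>0 < s\<close>, of 0] by simp
  also have "\<dots> \<le> integral {0..s} (\<lambda>x. D * exp (B * x))"
    unfolding real_norm_def[symmetric]
    by (rule integral_norm_bound_integral)
      (use D I in \<open>auto intro!: integrable_continuous_real continuous_intros continuous_on_subset[OF f]\<close>)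
  also have "\<dots> \<le> D * exp (B * s) / B"
    using integral_unique[OF I] D[of 0] B by (simp add: divide_nonneg_pos)
  finally show ?thesis .
qed

lemma continuous_on_lipschitz2:
  fixes h :: "real \<Rightarrow> real \<Rightarrow> real" and p q :: "'a::topological_space \<Rightarrow> real"
  assumes lip: "\<And>y c y' c'. \<bar>h y c - h y' c'\<bar> \<le> P * \<bar>y - y'\<bar> + M * \<bar>c - c'\<bar>"
    and "continuous_on A p" "continuous_on A q"
  shows "continuous_on A (\<lambda>x. h (p x) (q x))"
  unfolding continuous_on_def
proof
  fix a assume a: "a \<in> A"
  have lims: "(p \<longlongrightarrow> p a) (at a within A)" "(q \<longlongrightarrow> q a) (at a within A)"
    using assms a by (auto simp: continuous_on_def)
  have "((\<lambda>x. P * \<bar>p x - p a\<bar> + M * \<bar>q x - q a\<bar>) \<longlongrightarrow>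
      P * \<bar>p a - p a\<bar> + M * \<bar>q a - q a\<bar>) (at a within A)"
    by (intro tendsto_intros lims)
  then have "((\<lambda>x. P * \<bar>p x - p a\<bar> + M * \<bar>q x - q a\<bar>) \<longlongrightarrow> 0) (at a within A)" by simp
  then have "((\<lambda>x. h (p x) (q x) - h (p a) (q a)) \<longlongrightarrow> 0) (at a within A)"
    by (rule Lim_null_comparison[rotated])
      (unfold real_norm_def, intro always_eventually allI lip)
  then show "((\<lambda>x. h (p x) (q x)) \<longlongrightarrow> h (p a) (q a)) (at a within A)"
    by (rule LIM_zero_cancel)
qed

text \<open>Integral form of b v' = y, v(0) = 1, s y' + (k + 1) y = h(y, -v) / b. The y-dependence
  contributes P / (b (k + 1)) < 1 to the contraction factor; the rest, coming from v, is made small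
  by the exponential weight.\<close>

lemma singular_ode_fixpoint:
  fixes h :: "real \<Rightarrow> real \<Rightarrow> real"
  assumes lip: "\<And>y c y' c'. \<bar>h y c - h y' c'\<bar> \<le> P * \<bar>y - y'\<bar> + M * \<bar>c - c'\<bar>"
    and b: "0 < b" and P: "0 \<le> P" "P < b * (real k + 1)" and M: "0 < M"
  obtains y where "continuous_on UNIV y"
    "\<And>s. 0 \<le> s \<Longrightarrow>
      y s = moment_mean k (\<lambda>x. h (y x) (- (1 + x * moment_mean 0 y x / b))) s / b"
proof -
  \<comment> \<open>This B makes \<open>M / (b * B)\<close> half of the gap
    \<open>b * (real k + 1) - P\<close>, so that the contraction factor \<open>q\<close> is halfway
    between \<open>P / (b * (real k + 1))\<close> and 1.\<close>
  define B where "B = 2 * M / (b * (b * (real k + 1) - P))"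
  have B: "0 < B" using b P M by (simp add: B_def)
  \<comment> \<open>Banach's theorem is applied to z = y / W among bounded continuous functions on
    the whole line. Clamping at 0 extends everything to negative s; values there never enter the
    averages at s \<ge> 0.\<close>
  define W where "W = (\<lambda>s. exp (B * max 0 s))"
  have W: "W s = exp (B * s)" if "0 \<le> s" for s using that by (simp add: W_def max_def)
  have Wc: "continuous_on UNIV W" unfolding W_def by (intro continuous_intros)
  define V where "V = (\<lambda>y x. 1 + x * moment_mean 0 y x / b)"
  define R where "R = (\<lambda>y x. h (y x) (- V y x))"
  define Y where "Y = (\<lambda>(z :: real \<Rightarrow>\<^sub>C real) s. W s * z s)"
  define T where "T = (\<lambda>z s. moment_mean k (R (Y z)) (max 0 s) / b / W s)"
  have hc: "continuous_on UNIV (\<lambda>x. h (p x) (q x))"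
    if "continuous_on UNIV p" "continuous_on UNIV q" for p q :: "real \<Rightarrow> real"
    using lip that by (rule continuous_on_lipschitz2)
  have Yc: "continuous_on UNIV (Y z)" for z
    unfolding Y_def by (intro continuous_intros Wc) auto
  have Vc: "continuous_on UNIV (V y)" if "continuous_on UNIV y" for y
    unfolding V_def by (intro continuous_intros continuous_moment_mean that) (use b in auto)
  have Rc: "continuous_on UNIV (R (Y z))" for z
    unfolding R_def by (intro hc continuous_intros Yc Vc)
  have Tc: "continuous_on UNIV (T z)" for z
    unfolding T_def
    by (intro continuous_intros Wc continuous_on_compose2[OF continuous_moment_mean[OF Rc]])
       (use b in \<open>auto simp: W_def\<close>)
  have Vdiff: "\<bar>V p x - V q x\<bar> \<le> D * exp (B * x) / (b * B)"
    if "continuous_on UNIV p" "continuous_on UNIV q" "0 \<le> x"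
      "\<And>x. 0 \<le> x \<Longrightarrow> \<bar>p x - q x\<bar> \<le> D * exp (B * x)" for p q D x
  proof -
    have "V p x - V q x = x * moment_mean 0 (\<lambda>x. p x - q x) x / b"
      using moment_mean_diff[OF that(1,2), of 0 x]
      by (simp add: V_def diff_divide_distrib[symmetric] right_diff_distrib[symmetric])
    then have "\<bar>V p x - V q x\<bar> = \<bar>x * moment_mean 0 (\<lambda>x. p x - q x) x\<bar> / b"
      using b by simp
    also have "\<dots> \<le> D * exp (B * x) / B / b"
      using that B b by (intro divide_right_mono integral_exp_bound continuous_intros) auto
    finally show ?thesis by (simp add: mult.commute)
  qed
  have Rdiff: "\<bar>R p x - R q x\<bar> \<le> (P + M / (b * B)) * D * exp (B * x)"
    if "continuous_on UNIV p" "continuous_on UNIV q" "0 \<le> x"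
      "\<And>x. 0 \<le> x \<Longrightarrow> \<bar>p x - q x\<bar> \<le> D * exp (B * x)" for p q D x
  proof -
    have "\<bar>R p x - R q x\<bar> \<le> P * \<bar>p x - q x\<bar> + M * \<bar>- V p x - - V q x\<bar>"
      unfolding R_def by (rule lip)
    also have "\<dots> \<le> P * (D * exp (B * x)) + M * (D * exp (B * x) / (b * B))"
      using Vdiff[OF that] that(4)[OF that(3)] P M
      by (intro add_mono mult_left_mono) auto
    finally show ?thesis by (simp add: algebra_simps)
  qed
  define q where "q = (P + M / (b * B)) / (b * (real k + 1))"
  have MB: "M / (b * B) = (b * (real k + 1) - P) / 2"
    using b M P by (simp add: B_def field_simps)
  have q: "0 \<le> q" "q < 1"
    using b P M B unfolding q_def MB by (auto simp: field_simps)
  have mdiff: "\<bar>moment_mean k (R p) s - moment_mean k (R r) s\<bar> / b / W s \<le> q * D"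
    if "continuous_on UNIV p" "continuous_on UNIV r" "0 \<le> s"
      "\<And>x. 0 \<le> x \<Longrightarrow> \<bar>p x - r x\<bar> \<le> D * exp (B * x)" for p r D s
  proof -
    have c: "continuous_on UNIV (R p)" "continuous_on UNIV (R r)"
      unfolding R_def by (intro hc continuous_intros Vc that)+
    have "\<bar>moment_mean k (R p) s - moment_mean k (R r) s\<bar>
        \<le> (P + M / (b * B)) * D * exp (B * s) / (real k + 1)"
      unfolding moment_mean_diff[OF c]
      using Rdiff[OF that(1,2) _ that(4)] that(3) B
      by (intro moment_mean_exp_bound continuous_intros c) auto
    then have "\<bar>moment_mean k (R p) s - moment_mean k (R r) s\<bar> / b / W s
        \<le> (P + M / (b * B)) * D * exp (B * s) / (real k + 1) / b / W s"
      using b W[OF that(3)] by (intro divide_right_mono) auto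
    also have "\<dots> = q * D"
      using W[OF that(3)] by (simp add: q_def mult.commute)
    finally show ?thesis .
  qed
  \<comment> \<open>Boundedness follows from the contraction estimate itself, comparing
    \<open>Y z\<close> with the zero function, for which v = 1 and the integrand is the constant
    \<open>h 0 (-1)\<close>.\<close>
  have bdd: "T z \<in> bcontfun" for z
  proof (rule bcontfun_normI[OF Tc])
    fix s :: real
    define t where "t = max 0 s"
    have t: "0 \<le> t" "W s = W t" by (auto simp: t_def W_def)
    have "\<bar>Y z x - 0\<bar> \<le> norm z * exp (B * x)" if "0 \<le> x" for x
      using norm_bounded[of z x] that by (simp add: Y_def W abs_mult)
    from mdiff[OF Yc _ t(1) this]
    have 1: "\<bar>moment_mean k (R (Y z)) t - moment_mean k (R (\<lambda>_. 0)) t\<bar> / b / W t \<le> q * norm z"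
      by simp
    have R0: "R (\<lambda>_. 0) = (\<lambda>_. h 0 (-1))" by (simp add: R_def V_def moment_mean_def)
    have "\<bar>moment_mean k (R (\<lambda>_. 0)) t\<bar> \<le> \<bar>h 0 (-1)\<bar> * exp (B * t) / (real k + 1)"
      unfolding R0 using t B by (intro moment_mean_exp_bound)
        (auto intro!: mult_right_le_one_le mult_le_cancel_left1[THEN iffD2])
    then have "\<bar>moment_mean k (R (\<lambda>_. 0)) t\<bar> / b / W t
        \<le> \<bar>h 0 (-1)\<bar> * exp (B * t) / (real k + 1) / b / W t"
      using b t by (intro divide_right_mono) (auto simp: W)
    then have "\<bar>moment_mean k (R (\<lambda>_. 0)) t\<bar> / b / W t \<le> \<bar>h 0 (-1)\<bar> / (real k + 1) / b"
      using t by (simp add: W)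
    moreover have "\<bar>T z s\<bar> \<le> \<bar>moment_mean k (R (Y z)) t - moment_mean k (R (\<lambda>_. 0)) t\<bar> / b / W t
        + \<bar>moment_mean k (R (\<lambda>_. 0)) t\<bar> / b / W t"
      using b t by (simp add: T_def t_def[symmetric] W abs_mult add_divide_distrib[symmetric]
          divide_right_mono)
    ultimately show "norm (T z s) \<le> q * norm z + \<bar>h 0 (-1)\<bar> / (real k + 1) / b"
      using 1 by simp
  qed
  define S where "S = (\<lambda>z. Bcontfun (T z))"
  have S: "apply_bcontfun (S z) = T z" for z
    unfolding S_def by (rule Bcontfun_inverse[OF bdd])
  have "dist (S z) (S w) \<le> q * dist z w" for z w
  proof (rule dist_bound)
    fix s :: real
    define t where "t = max 0 s"
    have t: "0 \<le> t" "W s = W t" by (auto simp: t_def W_def)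
    have "\<bar>Y z x - Y w x\<bar> \<le> dist z w * exp (B * x)" if "0 \<le> x" for x
      using dist_bounded[of z x w] that
      by (simp add: Y_def W abs_mult dist_real_def right_diff_distrib[symmetric])
    from mdiff[OF Yc Yc t(1) this]
    have "\<bar>moment_mean k (R (Y z)) t - moment_mean k (R (Y w)) t\<bar> / b / W t \<le> q * dist z w" .
    moreover have "\<bar>T z s - T w s\<bar> = \<bar>moment_mean k (R (Y z)) t - moment_mean k (R (Y w)) t\<bar> / b / W t"
      using b t by (simp add: T_def t_def[symmetric] W diff_divide_distrib[symmetric])
    ultimately show "dist (S z s) (S w s) \<le> q * dist z w"
      by (simp add: S dist_real_def)
  qed
  with banach_fix_type[of q S] q obtain z where z: "S z = z" by blast
  show ?thesis
  proof
    show "continuous_on UNIV (Y z)" by (rule Yc)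
    fix s :: real assume s: "0 \<le> s"
    have "z s = T z s" using z S by metis
    then show "Y z s = moment_mean k (\<lambda>x. h (Y z x) (- (1 + x * moment_mean 0 (Y z) x / b))) s / b"
      using s by (simp add: Y_def T_def R_def V_def W max_def)
  qed
qed

text \<open>Differentiating the fixed-point identity recovers the system for s > 0. At s = 0 it
  leaves an algebraic compatibility condition on \<open>y 0\<close>, which later decides its
  sign.\<close>

lemma singular_ode:
  fixes h :: "real \<Rightarrow> real \<Rightarrow> real"
  assumes lip: "\<And>y c y' c'. \<bar>h y c - h y' c'\<bar> \<le> P * \<bar>y - y'\<bar> + M * \<bar>c - c'\<bar>"
    and b: "0 < b" and P: "0 \<le> P" "P < b * (real k + 1)" and M: "0 < M"
  obtains y v where "continuous_on UNIV y" "continuous_on UNIV v" "v 0 = 1"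
    "b * (real k + 1) * y 0 = h (y 0) (- 1)"
    "\<And>s. 0 < s \<Longrightarrow> (v has_real_derivative y s / b) (at s)"
    "\<And>s. 0 < s \<Longrightarrow>
      (y has_real_derivative (h (y s) (- v s) / b - (real k + 1) * y s) / s) (at s)"
proof -
  obtain y where y: "continuous_on UNIV y"
    and ye: "\<And>s. 0 \<le> s \<Longrightarrow>
      y s = moment_mean k (\<lambda>x. h (y x) (- (1 + x * moment_mean 0 y x / b))) s / b"
    by (rule singular_ode_fixpoint[OF lip b P M]) blast
  define v where "v = (\<lambda>x. 1 + x * moment_mean 0 y x / b)"
  define R where "R = (\<lambda>x. h (y x) (- v x))"
  have ye: "y s = moment_mean k R s / b" if "0 \<le> s" for s
    using ye[OF that] by (simp add: R_def v_def)
  have vc: "continuous_on UNIV v"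
    unfolding v_def by (intro continuous_intros continuous_moment_mean y) (use b in auto)
  have Rc: "continuous_on UNIV R"
    unfolding R_def using lip by (rule continuous_on_lipschitz2) (intro continuous_intros y vc)+
  have vd: "(v has_real_derivative y s / b) (at s)" if "0 < s" for s
  proof -
    have "((\<lambda>x. 1 + x * moment_mean 0 y x / b) has_real_derivative 0 + y s / b) (at s)"
      using moment_mean_power_deriv[OF y that, of 0] by (intro DERIV_add DERIV_cdivide) auto
    then show ?thesis by (simp add: v_def[abs_def])
  qed
  have yd: "(y has_real_derivative (h (y s) (- v s) / b - (real k + 1) * y s) / s) (at s)"
    if s: "0 < s" for s
  proof -
    \<comment> \<open>y is written as a quotient whose numerator s^(k+1) m(s) is an antiderivative;
      the quotient rule then replaces differentiation under the integral sign.\<close>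
    have "((\<lambda>s. b * s ^ Suc k) has_real_derivative b * (real (Suc k) * s ^ k)) (at s)"
      by (auto intro!: derivative_eq_intros simp del: power_Suc)
    with moment_mean_power_deriv[OF Rc s, of k]
    have d: "((\<lambda>s. s ^ Suc k * moment_mean k R s / (b * s ^ Suc k)) has_real_derivative
      (s ^ k * R s * (b * s ^ Suc k) - s ^ Suc k * moment_mean k R s * (b * (real (Suc k) * s ^ k)))
        / ((b * s ^ Suc k) * (b * s ^ Suc k))) (at s)"
      using b s by (intro DERIV_divide) auto
    have e: "(s ^ k * R s * (b * s ^ Suc k) -
        s ^ Suc k * moment_mean k R s * (b * (real (Suc k) * s ^ k)))
          / ((b * s ^ Suc k) * (b * s ^ Suc k))
        = (h (y s) (- v s) / b - (real k + 1) * y s) / s"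
    proof -
      have "(p * r * (b * (s * p)) - s * p * m * (b * (c * p))) / ((b * (s * p)) * (b * (s * p)))
          = (r / b - c * (m / b)) / s" if "p \<noteq> 0" for p r c m :: real
        using that b s by (simp add: divide_simps) (simp add: algebra_simps)
      from this[of "s ^ k" "R s" "moment_mean k R s" "real k + 1"] show ?thesis
        using s ye[of s] by (simp add: R_def add.commute[of 1])
    qed
    show ?thesis
      by (rule has_field_derivative_transform_within_open[OF d[unfolded e], of "{0<..}"])
        (use s b ye in auto)
  qed
  have v0: "v 0 = 1" by (simp add: v_def)
  have "y 0 = R 0 / (real k + 1) / b" using ye[of 0] by (simp add: moment_mean_0)
  then have "b * (real k + 1) * y 0 = R 0" using b by simp
  then have "b * (real k + 1) * y 0 = h (y 0) (- 1)" by (simp add: R_def v0)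
  from that[OF y vc v0 this vd yd] show ?thesis .
qed

section \<open>Radial profiles of elliptic operators\<close>

text \<open>\<open>Phi a b\<close> stands for F at a matrix with the simple eigenvalue
  \<open>a\<close> in the radial direction and \<open>b\<close> in the n = N - 1 tangential ones.
  Only slope bounds are imposed, because F need not be differentiable.\<close>

locale radial_operator =
  fixes Phi :: "real \<Rightarrow> real \<Rightarrow> real" and lam Lam n :: real
  assumes lam_pos: "0 < lam" and lam_le: "lam \<le> Lam" and dim: "Lam < lam * n"
    and fst_lower: "0 \<le> t \<Longrightarrow> lam * t \<le> Phi (a + t) b - Phi a b"
    and fst_upper: "0 \<le> t \<Longrightarrow> Phi (a + t) b - Phi a b \<le> Lam * t"
    and snd_lower: "0 \<le> t \<Longrightarrow> lam * n * t \<le> Phi a (b + t) - Phi a b"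
    and snd_upper: "0 \<le> t \<Longrightarrow> Phi a (b + t) - Phi a b \<le> Lam * n * t"
    and hom: "0 < t \<Longrightarrow> Phi (t * a) (t * b) = t * Phi a b"
begin

section \<open>Solving the radial equation for the second derivative\<close>

lemma Lam_pos: "0 < Lam" and n_pos: "0 < n"
proof -
  show "0 < Lam" using lam_pos lam_le by simp
  then have "0 < lam * n" using dim by simp
  then show "0 < n" using lam_pos by (simp add: zero_less_mult_iff)
qed

lemma Phi_0: "Phi 0 0 = 0"
  using hom[of 2 0 0] by simp

text \<open>The inverse of \<open>Phi\<close> in its first argument. The choice is unambiguous,
  since the slope in that argument is at least \<open>lam\<close> > 0.\<close>

definition G :: "real \<Rightarrow> real \<Rightarrow> real" where
  "G b c = (SOME a. Phi a b = c)"

lemma continuous_Phi_fst: "continuous_on UNIV (\<lambda>a. Phi a b)"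
proof (rule continuous_onI)
  fix x e :: real assume e: "0 < e"
  have 1: "\<bar>Phi w b - Phi z b\<bar> \<le> Lam * \<bar>w - z\<bar>" if "z \<le> w" for w z
  proof -
    have "0 \<le> lam * (w - z)" using lam_pos that by simp
    then show ?thesis using fst_lower[of "w - z" z b] fst_upper[of "w - z" z b] that by simp
  qed
  have "\<bar>Phi x' b - Phi x b\<bar> \<le> Lam * \<bar>x' - x\<bar>" for x'
    using 1[of x x'] 1[of x' x] by (cases "x \<le> x'") (auto simp: abs_minus_commute)
  moreover have "Lam * \<bar>x' - x\<bar> \<le> e" if "\<bar>x' - x\<bar> < e / Lam" for x'
    using that Lam_pos by (simp add: pos_less_divide_eq mult.commute)
  ultimately have "\<forall>x'\<in>UNIV. dist x' x < e / Lam \<longrightarrow> dist (Phi x' b) (Phi x b) \<le> e"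
    unfolding dist_real_def by (meson order_trans)
  then show "\<exists>d>0. \<forall>x'\<in>UNIV. dist x' x < d \<longrightarrow> dist (Phi x' b) (Phi x b) \<le> e"
    using e Lam_pos by (metis divide_pos_pos)
qed

lemma Phi_G: "Phi (G b c) b = c"
proof -
  \<comment> \<open>With this t the lower slope bound makes \<open>Phi t b\<close> at least c and
    \<open>Phi (- t) b\<close> at most c.\<close>
  define t where "t = \<bar>c - Phi 0 b\<bar> / lam"
  have t: "0 \<le> t" "lam * t = \<bar>c - Phi 0 b\<bar>" using lam_pos by (auto simp: t_def)
  have "Phi (-t) b \<le> c" "c \<le> Phi t b"
    using fst_lower[of t "-t" b] fst_lower[of t 0 b] t by auto
  then have "\<exists>a. Phi a b = c"
    using IVT'[of "\<lambda>a. Phi a b" "-t" c t] t(1) continuous_on_subset[OF continuous_Phi_fst subset_UNIV]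
    by (metis neg_le_0_iff_le order_trans)
  then show ?thesis unfolding G_def by (rule someI_ex)
qed

lemma G_snd:
  assumes "c \<le> c'"
  shows "(c' - c) / Lam \<le> G b c' - G b c" "G b c' - G b c \<le> (c' - c) / lam"
proof -
  have "G b c \<le> G b c'"
  proof (rule ccontr)
    assume *: "\<not> ?thesis"
    then have "lam * (G b c - G b c') \<le> c - c'"
      using fst_lower[of "G b c - G b c'" "G b c'" b] by (simp add: Phi_G)
    moreover have "0 < lam * (G b c - G b c')" using * lam_pos by simp
    ultimately show False using assms by simp
  qed
  then have "lam * (G b c' - G b c) \<le> c' - c" "c' - c \<le> Lam * (G b c' - G b c)"
    using fst_lower[of "G b c' - G b c" "G b c" b] fst_upper[of "G b c' - G b c" "G b c" b]
    by (simp_all add: Phi_G)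
  then show "(c' - c) / Lam \<le> G b c' - G b c" "G b c' - G b c \<le> (c' - c) / lam"
    using lam_pos Lam_pos by (simp_all add: field_simps)
qed

text \<open>An implicit-function estimate by slopes: raising b moves the value of \<open>Phi\<close>
  at a rate between lam n and Lam n, and compensating in the first argument costs between 1 / Lam
  and 1 / lam per unit. Hence the quotients of opposite ellipticity constants.\<close>

lemma G_fst:
  assumes "b \<le> b'"
  shows "lam * n / Lam * (b' - b) \<le> G b c - G b' c" "G b c - G b' c \<le> Lam * n / lam * (b' - b)"
proof -
  define d where "d = Phi (G b' c) b' - Phi (G b' c) b"
  have d: "lam * n * (b' - b) \<le> d" "d \<le> Lam * n * (b' - b)"
    using snd_lower[of "b' - b" "G b' c" b] snd_upper[of "b' - b" "G b' c" b] assms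
    by (simp_all add: d_def)
  have 0: "0 \<le> lam * n * (b' - b)" using lam_pos n_pos assms by simp
  have "Phi (G b' c) b = c - d" by (simp add: d_def Phi_G)
  then have e: "Phi (G b c) b - Phi (G b' c) b = d" by (simp add: Phi_G)
  have "G b' c \<le> G b c"
  proof (rule ccontr)
    assume *: "\<not> ?thesis"
    then have "lam * (G b' c - G b c) \<le> - d"
      using fst_lower[of "G b' c - G b c" "G b c" b] e by simp
    moreover have "0 < lam * (G b' c - G b c)" using * lam_pos by simp
    ultimately show False using d 0 by simp
  qed
  then have "lam * (G b c - G b' c) \<le> d" "d \<le> Lam * (G b c - G b' c)"
    using fst_lower[of "G b c - G b' c" "G b' c" b] fst_upper[of "G b c - G b' c" "G b' c" b] e
    by simp_all
  with d have "lam * (G b c - G b' c) \<le> Lam * n * (b' - b)"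
    "lam * n * (b' - b) \<le> Lam * (G b c - G b' c)" by linarith+
  then show "lam * n / Lam * (b' - b) \<le> G b c - G b' c" "G b c - G b' c \<le> Lam * n / lam * (b' - b)"
    using lam_pos Lam_pos by (simp_all add: field_simps)
qed

lemma G_0: "G 0 0 = 0"
proof (rule ccontr)
  assume "G 0 0 \<noteq> 0"
  moreover have "Phi (G 0 0) 0 = 0" by (rule Phi_G)
  ultimately show False
    using fst_lower[of "G 0 0" 0 0] fst_lower[of "- G 0 0" "G 0 0" 0] Phi_0 lam_pos
    by (cases "0 < G 0 0") (auto simp: mult_le_0_iff zero_le_mult_iff)
qed

lemma slope_bounds: "1 < lam * n / Lam" "lam * n / Lam \<le> Lam * n / lam"
proof -
  show "1 < lam * n / Lam" using dim Lam_pos by (simp add: field_simps)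
  have "lam * lam \<le> Lam * Lam" using lam_pos lam_le by (intro mult_mono) auto
  then show "lam * n / Lam \<le> Lam * n / lam"
    using lam_pos Lam_pos n_pos by (simp add: field_simps)
qed

text \<open>Once K dominates the steepest descent of \<open>G\<close>, the sum K y + G is
  nondecreasing in y, so only the gentlest descent lam n / Lam enters its Lipschitz
  constant.\<close>

lemma G_lipschitz:
  assumes "Lam * n / lam \<le> K"
  shows "\<bar>(K * y + G y c) - (K * y' + G y' c')\<bar>
    \<le> (K - lam * n / Lam) * \<bar>y - y'\<bar> + 1 / lam * \<bar>c - c'\<bar>"
proof -
  have 1: "\<bar>(K * y + G y c) - (K * y' + G y' c)\<bar> \<le> (K - lam * n / Lam) * \<bar>y - y'\<bar>"
    if "y' \<le> y" for y y'
  proof -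
    have "Lam * n / lam * (y - y') \<le> K * (y - y')"
      using assms that by (intro mult_right_mono) auto
    then show ?thesis
      using G_fst[OF that, of c] that by (simp add: algebra_simps abs_if)
  qed
  have "\<bar>(K * y + G y c) - (K * y' + G y' c)\<bar> \<le> (K - lam * n / Lam) * \<bar>y - y'\<bar>"
    using 1[of y y'] 1[of y' y] by (cases "y \<le> y'") (auto simp: abs_minus_commute)
  moreover have "\<bar>G y' c - G y' c'\<bar> \<le> 1 / lam * \<bar>c - c'\<bar>"
  proof -
    have "\<bar>G y' c - G y' c'\<bar> \<le> 1 / lam * \<bar>c - c'\<bar>" if "c \<le> c'" for c c'
    proof -
      have "0 \<le> (c' - c) / Lam" using that Lam_pos by simp
      then show ?thesis using G_snd[OF that, of y'] that by (simp add: abs_if)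
    qed
    from this[of c c'] this[of c' c] show ?thesis
      by (cases "c \<le> c'") (auto simp: abs_minus_commute)
  qed
  ultimately show ?thesis by linarith
qed

lemma continuous_on_G:
  assumes "continuous_on A p" "continuous_on A q"
  shows "continuous_on A (\<lambda>x. G (p x) (q x))"
proof -
  define K where "K = Lam * n / lam"
  have "continuous_on A (\<lambda>x. K * p x + G (p x) (q x))"
    by (rule continuous_on_lipschitz2[OF G_lipschitz assms]) (simp add: K_def)
  then have "continuous_on A (\<lambda>x. K * p x + G (p x) (q x) - K * p x)"
    by (rule continuous_on_diff) (intro continuous_intros assms)
  then show ?thesis by (simp only: add_diff_cancel_left')
qed

section \<open>Existence, sign and first zero of the radial solution\<close>

lemma G_upper:
  assumes "y \<le> 0" "0 \<le> v"
  shows "G y (- v) \<le> Lam * n / lam * (- y) - v / Lam"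
  using G_fst(2)[of y 0 "- v"] G_snd(1)[of "- v" 0 0] assms G_0 by simp

text \<open>With \<open>s = r powr b\<close>, \<open>v' = y / b\<close> and \<open>\<phi>(r) = v (s)\<close> one has
  \<open>r \<phi>'(r) = s y\<close> and \<open>r\<^sup>2 \<phi>''(r) = s G(y, - v)\<close>. The radial equation with
  potential \<open>r powr (b - 2)\<close> thus becomes \<open>s y' + y = (y + G(y, - v)) / b\<close>.\<close>
lemma radial_solution:
  assumes b: "0 < b"
  obtains y v where "continuous_on UNIV y" "continuous_on UNIV v" "v 0 = 1" "y 0 < 0"
    "\<And>s. 0 < s \<Longrightarrow> (v has_real_derivative y s / b) (at s)"
    "\<And>s. 0 < s \<Longrightarrow> (y has_real_derivative ((y s + G (y s) (- v s)) / b - y s) / s) (at s)"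
proof -
  obtain k :: nat where k: "Lam * n / lam < real k * b"
    using ex_less_of_nat_mult[OF b] by blast
  \<comment> \<open>The coefficient of y after adding k y to both sides: (y + G) / b + k y = ((1 + k
    b) y + G) / b.\<close>
  define K where "K = 1 + real k * b"
  have K: "Lam * n / lam \<le> K" using k by (simp add: K_def)
  \<comment> \<open>In the second inequality k b cancels and leaves 1 - lam n / Lam < b, whose left
    side is negative.\<close>
  have P: "0 \<le> K - lam * n / Lam" "K - lam * n / Lam < b * (real k + 1)"
    using K slope_bounds b by (simp_all add: K_def distrib_left mult.commute)
  have M: "0 < 1 / lam" using lam_pos by simp
  obtain y v where yv: "continuous_on UNIV y" "continuous_on UNIV v" "v 0 = 1"
    "b * (real k + 1) * y 0 = K * y 0 + G (y 0) (- 1)"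
    "\<And>s. 0 < s \<Longrightarrow> (v has_real_derivative y s / b) (at s)"
    "\<And>s. 0 < s \<Longrightarrow> (y has_real_derivative
        ((K * y s + G (y s) (- v s)) / b - (real k + 1) * y s) / s) (at s)"
    by (rule singular_ode[OF G_lipschitz[OF K] b P M]) blast
  have e: "(K * y s + G (y s) (- v s)) / b - (real k + 1) * y s
      = (y s + G (y s) (- v s)) / b - y s" for s
    using b by (simp add: K_def field_simps)
  \<comment> \<open>The compatibility condition reads (b - 1) y 0 = G (y 0) (- 1). For y 0 \<ge> 0
    the right side is at most - (lam n / Lam) y 0 - 1 / Lam, which is incompatible with lam n / Lam
    > 1.\<close>
  have "y 0 < 0"
  proof (rule ccontr)
    assume "\<not> y 0 < 0"
    then have y0: "0 \<le> y 0" by simp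
    have "G (y 0) (- 1) \<le> - (lam * n / Lam * y 0) - 1 / Lam"
      using G_fst(1)[of 0 "y 0" "-1"] G_snd(1)[of "-1" 0 0] G_0 y0 by simp
    then have "(b - 1) * y 0 \<le> - (lam * n / Lam * y 0) - 1 / Lam"
      using yv(4) by (simp add: K_def algebra_simps)
    moreover have "1 * y 0 \<le> lam * n / Lam * y 0"
      using slope_bounds(1) y0 by (intro mult_right_mono) auto
    ultimately have "b * y 0 \<le> - 1 / Lam" by (simp add: algebra_simps)
    moreover have "- 1 / Lam < 0" using Lam_pos by simp
    moreover have "0 \<le> b * y 0" using b y0 by simp
    ultimately show False by linarith
  qed
  from that[OF yv(1-3) this yv(5) yv(6)[unfolded e]] show ?thesis .
qed

text \<open>While v \<ge> 0 and y < 0, the product s y satisfies (s y)' \<le> - \<theta> y. Thus s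
  powr \<theta> is an integrating factor, and y, negative at the start, cannot climb back to a first
  zero.\<close>

lemma radial_solution_decreasing:
  assumes b: "0 < b" and y: "continuous_on UNIV y" "y 0 < 0"
    and yd: "\<And>s. 0 < s \<Longrightarrow>
      (y has_real_derivative ((y s + G (y s) (- v s)) / b - y s) / s) (at s)"
    and v: "\<And>s. 0 \<le> s \<Longrightarrow> s \<le> r \<Longrightarrow> 0 \<le> v s" and s: "0 \<le> s" "s \<le> r"
  shows "y s < 0"
proof (rule ccontr)
  assume "\<not> y s < 0"
  define Z where "Z = {0..s} \<inter> {t. 0 \<le> y t}"
  define \<tau> where "\<tau> = Inf Z"
  define \<theta> where "\<theta> = (Lam * n / lam - 1) / b"
  have "closed Z" unfolding Z_def using y(1)
    by (intro closed_Int closed_Collect_le continuous_intros) auto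
  moreover have "Z \<noteq> {}" "bdd_below Z" using \<open>\<not> y s < 0\<close> s by (auto simp: Z_def)
  ultimately have "\<tau> \<in> Z" unfolding \<tau>_def by (intro closed_contains_Inf) auto
  then have \<tau>: "0 \<le> y \<tau>" "0 < \<tau>" "\<tau> \<le> s" using y(2) by (auto simp: Z_def order_less_le)
  have neg: "y t < 0" if "0 \<le> t" "t < \<tau>" for t
    using cInf_lower[of t Z] \<open>bdd_below Z\<close> that \<tau> by (force simp: Z_def \<tau>_def)
  \<comment> \<open>Its derivative is t powr \<theta> times (\<theta> y + D), where D = (t y)' by
    the system.\<close>
  define Q where "Q = (\<lambda>t. t powr \<theta> * (t * y t))"
  have "Q \<tau> \<le> Q (\<tau> / 2)"
  proof (rule DERIV_nonpos_imp_decreasing_open[where f=Q])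
    show "continuous_on {\<tau> / 2..\<tau>} Q"
      unfolding Q_def using \<tau> by (intro continuous_intros continuous_on_subset[OF y(1)]) auto
    fix t assume t: "\<tau> / 2 < t" "t < \<tau>"
    then have t0: "0 < t" using \<tau> by simp
    define D where "D = (y t + G (y t) (- v t)) / b"
    have "(Q has_real_derivative \<theta> * t powr (\<theta> - 1) * (t * y t) +
        (1 * y t + (D - y t) / t * t) * t powr \<theta>) (at t)"
      unfolding Q_def D_def
      by (intro DERIV_mult DERIV_ident yd t0 has_real_derivative_powr)
    moreover have "\<theta> * t powr (\<theta> - 1) * (t * y t) + (1 * y t + (D - y t) / t * t) * t powr \<theta>
        = t powr \<theta> * (\<theta> * y t + D)"
      using t0 by (simp add: powr_diff divide_simps) (simp add: algebra_simps)
    moreover have "\<theta> * y t + D \<le> 0"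
    proof -
      have "0 \<le> v t" "y t < 0" using v[of t] neg[of t] t t0 \<tau> s by auto
      moreover from this have "0 \<le> v t / Lam" using Lam_pos by simp
      ultimately have "G (y t) (- v t) \<le> Lam * n / lam * (- y t)"
        using G_upper[of "y t" "v t"] by linarith
      then have "D \<le> (y t + Lam * n / lam * (- y t)) / b"
        unfolding D_def using b by (intro divide_right_mono) auto
      also have "\<dots> = - \<theta> * y t" by (simp add: \<theta>_def algebra_simps diff_divide_distrib)
      finally show ?thesis by simp
    qed
    ultimately show "\<exists>y. (Q has_real_derivative y) (at t) \<and> y \<le> 0"
      by (metis mult_nonneg_nonpos powr_ge_zero)
  qed (use \<tau> in auto)
  moreover have "Q (\<tau> / 2) < 0"
    unfolding Q_def using \<tau> neg[of "\<tau> / 2"] by (simp add: mult_pos_neg)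
  moreover have "0 \<le> Q \<tau>" unfolding Q_def using \<tau> by simp
  ultimately show False by simp
qed

text \<open>As long as \<open>v > 0\<close>, the quotient \<open>E = v / (s y)\<close> is negative and satisfies the Riccati
  inequality \<open>E' \<ge> 1 / (b s) + \<theta> E / s + E\<^sup>2 / (\<Lambda> b)\<close>; for large \<open>s\<close> this forces \<open>E\<close> to grow
  at least like a multiple of \<open>ln s\<close>.\<close>
lemma radial_solution_vanishes:
  assumes b: "0 < b" and y: "continuous_on UNIV y" "y 0 < 0" and v0: "v 0 = 1"
    and vc: "continuous_on UNIV v"
    and vd: "\<And>s. 0 < s \<Longrightarrow> (v has_real_derivative y s / b) (at s)"
    and yd: "\<And>s. 0 < s \<Longrightarrow>
      (y has_real_derivative ((y s + G (y s) (- v s)) / b - y s) / s) (at s)"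
  shows "\<exists>s>0. v s = 0"
proof (rule ccontr)
  assume nz: "\<not> ?thesis"
  have pos: "0 < v s" if s: "0 \<le> s" for s
  proof (rule ccontr)
    assume "\<not> 0 < v s"
    then obtain t where "0 \<le> t" "t \<le> s" "v t = 0"
      using IVT2'[of v s 0 0] v0 s continuous_on_subset[OF vc] by auto
    then show False using nz v0 by (cases "t = 0") auto
  qed
  have neg: "y s < 0" if "0 \<le> s" for s
    using radial_solution_decreasing[OF b y yd _ that order_refl] pos by (simp add: less_imp_le)
  define \<theta> where "\<theta> = (Lam * n / lam - 1) / b"
  define E where "E = (\<lambda>s. v s / (s * y s))"
  \<comment> \<open>From this point on, the error left by completing the square in E is at most half
    of the term 1 / (b s). The added 1 keeps \<open>s0\<close> positive.\<close>
  define s0 where "s0 = \<theta>\<^sup>2 * Lam * b\<^sup>2 / 2 + 1"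
  have s0: "0 < s0" unfolding s0_def using Lam_pos by (intro add_nonneg_pos) auto
  have Ed: "\<exists>d. (E has_real_derivative d) (at s) \<and> 1 / (2 * b * s) \<le> d" if "s0 \<le> s" for s
  proof -
    have s: "0 < s" using that s0 by simp
    define D where "D = (y s + G (y s) (- v s)) / b"
    define q where "q = s * y s"
    have q: "q < 0" unfolding q_def using neg[of s] s by (simp add: mult_pos_neg)
    have "((\<lambda>s. s * y s) has_real_derivative 1 * y s + (D - y s) / s * s) (at s)"
      unfolding D_def by (intro DERIV_mult DERIV_ident yd s)
    then have "((\<lambda>s. s * y s) has_real_derivative D) (at s)" using s by simp
    with vd[OF s] have "(E has_real_derivative (y s / b * q - v s * D) / (q * q)) (at s)"
      unfolding E_def q_def using q by (intro DERIV_divide) (auto simp: q_def)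
    moreover have "1 / (2 * b * s) \<le> (y s / b * q - v s * D) / (q * q)"
    proof -
      have "D \<le> (y s + (Lam * n / lam * (- y s) - v s / Lam)) / b"
        unfolding D_def using b G_upper[of "y s" "v s"] pos[of s] neg[of s] s
        by (intro divide_right_mono) auto
      also have "\<dots> = - \<theta> * y s - v s / (Lam * b)"
        using b Lam_pos by (simp add: \<theta>_def algebra_simps diff_divide_distrib add_divide_distrib)
      also have "y s = q / s" using s by (simp add: q_def)
      finally have "v s * D \<le> v s * (- \<theta> * (q / s) - v s / (Lam * b))"
        using pos[of s] s by (intro mult_left_mono) auto
      moreover have "q * q / (2 * b * s) \<le> q * q / (b * s) + \<theta> * q * v s / s + (v s)\<^sup>2 / (Lam * b)"
      proof -
        \<comment> \<open>The Riccati inequality multiplied by q^2 with q = s y: completing the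
          square in v leaves a remainder of order q^2 / s^2, dominated by q^2 / s for large
          s.\<close>
        have "0 \<le> (v s + \<theta> * Lam * b * q / (2 * s))\<^sup>2 / (Lam * b)"
          using Lam_pos b by simp
        also have "\<dots> = (v s)\<^sup>2 / (Lam * b) + \<theta> * q * v s / s + \<theta>\<^sup>2 * Lam * b * q\<^sup>2 / (4 * s\<^sup>2)"
          using Lam_pos b s by (simp add: power2_eq_square field_simps)
        finally have "0 \<le> (v s)\<^sup>2 / (Lam * b) + \<theta> * q * v s / s + \<theta>\<^sup>2 * Lam * b * q\<^sup>2 / (4 * s\<^sup>2)" .
        moreover have "\<theta>\<^sup>2 * Lam * b * q\<^sup>2 / (4 * s\<^sup>2) \<le> q * q / (2 * b * s)"
        proof -
          have "\<theta>\<^sup>2 * Lam * b\<^sup>2 * q\<^sup>2 \<le> 2 * s * q\<^sup>2"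
            using that by (intro mult_right_mono) (auto simp: s0_def)
          then show ?thesis using b s by (simp add: power2_eq_square field_simps)
        qed
        moreover have "q * q / (b * s) = q * q / (2 * b * s) + q * q / (2 * b * s)"
          using b s by (simp add: field_simps)
        ultimately show ?thesis by linarith
      qed
      moreover have "y s / b * q = q * q / (b * s)" using s b by (simp add: q_def)
      moreover have "v s * (- \<theta> * (q / s) - v s / (Lam * b))
          = - (\<theta> * q * v s / s) - (v s)\<^sup>2 / (Lam * b)"
        by (simp add: power2_eq_square algebra_simps)
      ultimately have "q * q / (2 * b * s) \<le> y s / b * q - v s * D" by linarith
      moreover have "0 < q * q" using q by (simp add: mult_neg_neg)
      ultimately show ?thesis by (simp add: pos_le_divide_eq mult.commute)
    qed
    ultimately show ?thesis by blast
  qed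
  \<comment> \<open>The point where the logarithmic lower bound E s0 + (ln s - ln s0) / (2 b)
    reaches 0.\<close>
  define s1 where "s1 = s0 * exp (2 * b * (- E s0))"
  have Eneg: "E s < 0" if "0 < s" for s
    unfolding E_def using that pos[of s] neg[of s] by (simp add: divide_pos_neg mult_pos_neg)
  have s1: "s0 \<le> s1" unfolding s1_def using s0 b Eneg[OF s0]
    by (simp add: mult_nonneg_nonpos2 less_imp_le mult_nonneg_nonpos)
  have "E s0 - ln s0 / (2 * b) \<le> E s1 - ln s1 / (2 * b)"
  proof (rule DERIV_nonneg_imp_nondecreasing[OF s1, where f="\<lambda>s. E s - ln s / (2 * b)"])
    fix s assume s: "s0 \<le> s" "s \<le> s1"
    with Ed[of s] obtain d where d: "(E has_real_derivative d) (at s)" "1 / (2 * b * s) \<le> d"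
      by blast
    have "((\<lambda>s. E s - ln s / (2 * b)) has_real_derivative d - (1 / s) / (2 * b)) (at s)"
      using s s0 by (intro DERIV_diff DERIV_cdivide d(1) DERIV_ln_divide) auto
    then show "\<exists>d. ((\<lambda>s. E s - ln s / (2 * b)) has_real_derivative d) (at s) \<and> 0 \<le> d"
      using d(2) by (intro exI conjI) (auto simp: mult_ac)
  qed
  moreover have "ln s1 = ln s0 + 2 * b * (- E s0)"
    unfolding s1_def using s0 by (simp add: ln_mult)
  ultimately have "0 \<le> E s1" using b by (simp add: add_divide_distrib diff_divide_distrib)
  then show False using Eneg[of s1] s0 s1 by simp
qed

lemma radial_eigenfunction:
  assumes b: "0 < b"
  obtains S y v where "0 < S" "continuous_on UNIV y" "continuous_on UNIV v" "v 0 = 1" "v S = 0"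
    "\<And>s. 0 \<le> s \<Longrightarrow> s < S \<Longrightarrow> 0 < v s" "\<And>s. 0 \<le> s \<Longrightarrow> s \<le> S \<Longrightarrow> y s < 0"
    "\<And>s. 0 < s \<Longrightarrow> (v has_real_derivative y s / b) (at s)"
    "\<And>s. 0 < s \<Longrightarrow> (y has_real_derivative ((y s + G (y s) (- v s)) / b - y s) / s) (at s)"
proof (rule radial_solution[OF b])
  fix y v assume yv: "continuous_on UNIV y" "continuous_on UNIV v" "v 0 = 1" "y 0 < 0"
    "\<And>s. 0 < s \<Longrightarrow> (v has_real_derivative y s / b) (at s)"
    "\<And>s. 0 < s \<Longrightarrow> (y has_real_derivative ((y s + G (y s) (- v s)) / b - y s) / s) (at s)"
  define Z where "Z = {0..} \<inter> {s. v s = 0}"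
  define S where "S = Inf Z"
  have "closed Z" unfolding Z_def using yv(2)
    by (intro closed_Int closed_Collect_eq continuous_intros) auto
  moreover have bd: "bdd_below Z" by (auto simp: Z_def)
  moreover have "Z \<noteq> {}"
    using radial_solution_vanishes[OF b yv(1,4,3,2,5,6)] by (auto simp: Z_def intro: less_imp_le)
  ultimately have "S \<in> Z" unfolding S_def by (intro closed_contains_Inf) auto
  then have S: "v S = 0" "0 < S" using yv(3) by (auto simp: Z_def order_less_le)
  have pos: "0 < v s" if s: "0 \<le> s" "s < S" for s
  proof (rule ccontr)
    assume "\<not> 0 < v s"
    then obtain t where "0 \<le> t" "t \<le> s" "v t = 0"
      using IVT2'[of v s 0 0] yv(3) s continuous_on_subset[OF yv(2)] by auto
    then have "S \<le> t" unfolding S_def using bd by (intro cInf_lower) (auto simp: Z_def)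
    then show False using \<open>t \<le> s\<close> s by simp
  qed
  have "0 \<le> v s" if "0 \<le> s" "s \<le> S" for s
    using pos[of s] S that by (cases "s = S") auto
  \<comment> \<open>The endpoint s = S is included: a nonzero slope at the zero, as in Hopf's lemma,
    which the barrier needs near r = 1.\<close>
  then have "y s < 0" if "0 \<le> s" "s \<le> S" for s
    using radial_solution_decreasing[OF b yv(1,4,6) _ that] by simp
  from that[OF S(2) yv(1-3) S(1) pos this yv(5,6)] show ?thesis .
qed

end

section \<open>Test functions of class \<open>C\<^sup>2\<close> and viscosity inequalities\<close>

lemma real_derivative_line:
  fixes \<phi> :: "real^'n \<Rightarrow> real"
  assumes "GDERIV \<phi> (x + t *\<^sub>R h) :> g"
  shows "((\<lambda>t. \<phi> (x + t *\<^sub>R h)) has_real_derivative h \<bullet> g) (at t)"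
proof -
  have "((\<lambda>t. x + t *\<^sub>R h) has_derivative (\<lambda>s. s *\<^sub>R h)) (at t)"
    by (auto intro!: derivative_eq_intros)
  from has_derivative_compose[OF this assms[unfolded gderiv_def]]
  show ?thesis by (simp add: has_field_derivative_def mult_commute_abs)
qed

lemma real_derivative_line_inner:
  fixes g :: "real^'n \<Rightarrow> real^'n"
  assumes "(g has_derivative (\<lambda>h. H *v h)) (at (x + t *\<^sub>R h))"
  shows "((\<lambda>t. k \<bullet> g (x + t *\<^sub>R h)) has_real_derivative k \<bullet> (H *v h)) (at t)"
proof -
  have "((\<lambda>t. x + t *\<^sub>R h) has_derivative (\<lambda>s. s *\<^sub>R h)) (at t)"
    by (auto intro!: derivative_eq_intros)
  from has_derivative_inner_right[OF has_derivative_compose[OF this assms], of k]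
  show ?thesis
    by (simp add: has_field_derivative_def mult_commute_abs matrix_vector_mult_scaleR)
qed

lemma has_C2_hessian_on_subset:
  "has_C2_hessian_on U \<phi> g H \<Longrightarrow> V \<subseteq> U \<Longrightarrow> has_C2_hessian_on V \<phi> g H"
  unfolding has_C2_hessian_on_def using continuous_on_subset by blast

lemma has_C2_hessian_on_diff:
  assumes "has_C2_hessian_on U \<phi> g H" "has_C2_hessian_on U \<psi> g' H'"
  shows "has_C2_hessian_on U (\<lambda>x. \<phi> x - \<psi> x) (\<lambda>x. g x - g' x) (\<lambda>x. H x - H' x)"
proof -
  have "((\<lambda>x. g x - g' x) has_derivative (\<lambda>h. (H x - H' x) *v h)) (at x)" if "x \<in> U" for x
    unfolding matrix_vector_mult_diff_rdistrib
    using assms that by (intro has_derivative_diff) (auto simp: has_C2_hessian_on_def)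
  then show ?thesis
    using assms unfolding has_C2_hessian_on_def by (auto intro!: GDERIV_diff continuous_on_diff)
qed

lemma has_C2_hessian_on_scaleR:
  assumes "has_C2_hessian_on U \<phi> g H"
  shows "has_C2_hessian_on U (\<lambda>x. c * \<phi> x) (\<lambda>x. c *\<^sub>R g x) (\<lambda>x. c *\<^sub>R H x)"
proof -
  have "((\<lambda>x. c *\<^sub>R g x) has_derivative (\<lambda>h. (c *\<^sub>R H x) *v h)) (at x)" if "x \<in> U" for x
    unfolding scaleR_matrix_vector_assoc[symmetric]
    using assms that by (intro has_derivative_scaleR_right) (auto simp: has_C2_hessian_on_def)
  then show ?thesis
    using assms unfolding has_C2_hessian_on_def gderiv_def inner_scaleR_right
    by (auto intro!: has_derivative_mult_right continuous_intros)
qed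

text \<open>The mean value theorem, once in each direction. The left side is symmetric in h and k,
  which yields the equality of mixed derivatives.\<close>

lemma second_difference:
  fixes \<phi> :: "real^'n \<Rightarrow> real"
  assumes C2: "has_C2_hessian_on W \<phi> g H" and t: "0 < t"
    and W: "\<And>a b. 0 \<le> a \<Longrightarrow> a \<le> t \<Longrightarrow> 0 \<le> b \<Longrightarrow> b \<le> t \<Longrightarrow> x + a *\<^sub>R h + b *\<^sub>R k \<in> W"
  shows "\<exists>a b. 0 \<le> a \<and> a \<le> t \<and> 0 \<le> b \<and> b \<le> t \<and>
    \<phi> (x + t *\<^sub>R h + t *\<^sub>R k) - \<phi> (x + t *\<^sub>R h) - (\<phi> (x + t *\<^sub>R k) - \<phi> x)
      = t * (t * (h \<bullet> (H (x + a *\<^sub>R h + b *\<^sub>R k) *v k)))"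
proof -
  define f where "f = (\<lambda>s. \<phi> (x + t *\<^sub>R k + s *\<^sub>R h) - \<phi> (x + s *\<^sub>R h))"
  have g: "GDERIV \<phi> y :> g y" and H: "(g has_derivative (\<lambda>h. H y *v h)) (at y)"
    if "y \<in> W" for y
    using C2 that by (auto simp: has_C2_hessian_on_def)
  have "(f has_real_derivative h \<bullet> g (x + t *\<^sub>R k + s *\<^sub>R h) - h \<bullet> g (x + s *\<^sub>R h)) (at s)"
    if "0 \<le> s" "s \<le> t" for s
    unfolding f_def using W[of s t] W[of s 0] that t
    by (intro DERIV_diff real_derivative_line g) (auto simp: add_ac)
  from MVT2[OF t this] obtain a where a: "0 < a" "a < t"
    "f t - f 0 = t * (h \<bullet> g (x + t *\<^sub>R k + a *\<^sub>R h) - h \<bullet> g (x + a *\<^sub>R h))" by auto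
  have "((\<lambda>s. h \<bullet> g (x + a *\<^sub>R h + s *\<^sub>R k)) has_real_derivative
      h \<bullet> (H (x + a *\<^sub>R h + s *\<^sub>R k) *v k)) (at s)"
    if "0 \<le> s" "s \<le> t" for s
    using W[of a s] that a by (intro real_derivative_line_inner H) auto
  from MVT2[OF t this] obtain b where b: "0 < b" "b < t"
    "h \<bullet> g (x + a *\<^sub>R h + t *\<^sub>R k) - h \<bullet> g (x + a *\<^sub>R h)
      = t * (h \<bullet> (H (x + a *\<^sub>R h + b *\<^sub>R k) *v k))" by auto
  have "f t - f 0 = \<phi> (x + t *\<^sub>R h + t *\<^sub>R k) - \<phi> (x + t *\<^sub>R h) - (\<phi> (x + t *\<^sub>R k) - \<phi> x)"
    by (simp add: f_def add_ac)
  moreover have "x + t *\<^sub>R k + a *\<^sub>R h = x + a *\<^sub>R h + t *\<^sub>R k" by (simp add: add_ac)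
  ultimately show ?thesis using a b by (intro exI[of _ a] exI[of _ b]) simp
qed

text \<open>Schwarz's theorem. It brings Hessians of test functions into the set of symmetric
  matrices, the only place where anything is assumed about F.\<close>

lemma C2_hessian_symmetric:
  fixes \<phi> :: "real^'n \<Rightarrow> real"
  assumes C2: "has_C2_hessian_on W \<phi> g H" and W: "open W" "x \<in> W"
  shows "H x \<in> sym_matrices"
proof -
  have Hc: "isCont H x"
    using C2 W by (auto simp: has_C2_hessian_on_def continuous_on_eq_continuous_at)
  have sym: "h \<bullet> (H x *v k) = k \<bullet> (H x *v h)" for h k
  proof (rule ccontr)
    assume ne: "\<not> ?thesis"
    define e where "e = \<bar>h \<bullet> (H x *v k) - k \<bullet> (H x *v h)\<bar> / 2"
    have e: "0 < e" using ne by (simp add: e_def)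
    have c: "isCont (\<lambda>y. p \<bullet> (H y *v q)) x" for p q
      using Hc by (intro continuous_intros bounded_linear.isCont[of "\<lambda>A. A *v q"])
        (auto intro!: linear_linear[THEN iffD2] linearI simp: algebra_simps
          scaleR_matrix_vector_assoc linear_conv_bounded_linear[symmetric])
    obtain d1 where d1: "0 < d1"
      "\<And>y. dist y x < d1 \<Longrightarrow> \<bar>h \<bullet> (H y *v k) - h \<bullet> (H x *v k)\<bar> < e"
      using c[of h k] e unfolding continuous_at_eps_delta dist_real_def by blast
    obtain d2 where d2: "0 < d2"
      "\<And>y. dist y x < d2 \<Longrightarrow> \<bar>k \<bullet> (H y *v h) - k \<bullet> (H x *v h)\<bar> < e"
      using c[of k h] e unfolding continuous_at_eps_delta dist_real_def by blast
    obtain d3 where d3: "0 < d3" "ball x d3 \<subseteq> W" using W open_contains_ball by blast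
    define d where "d = min d1 (min d2 d3)"
    have d: "0 < d" "d \<le> d1" "d \<le> d2" "d \<le> d3" using d1 d2 d3 by (auto simp: d_def)
    \<comment> \<open>Small enough that every intermediate point supplied by
      \<open>second_difference\<close> stays within d of x; the 1 covers h = k = 0.\<close>
    define t where "t = d / (2 * (norm h + norm k + 1))"
    have t: "0 < t" unfolding t_def using d by (intro divide_pos_pos) (auto simp: add_nonneg_pos)
    have near: "dist (x + a *\<^sub>R h + b *\<^sub>R k) x < d" if "0 \<le> a" "a \<le> t" "0 \<le> b" "b \<le> t" for a b
    proof -
      have "dist (x + a *\<^sub>R h + b *\<^sub>R k) x = norm (a *\<^sub>R h + b *\<^sub>R k)"
        by (simp add: dist_norm add.assoc)
      also have "\<dots> \<le> a * norm h + b * norm k"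
        using norm_triangle_ineq[of "a *\<^sub>R h" "b *\<^sub>R k"] that by simp
      also have "\<dots> \<le> t * norm h + t * norm k"
        using that by (intro add_mono mult_right_mono) auto
      also have "\<dots> < t * (2 * (norm h + norm k + 1))"
      proof -
        have "0 < t * (norm h + norm k + 2)" using t by (intro mult_pos_pos add_nonneg_pos) auto
        then show ?thesis by (simp add: algebra_simps)
      qed
      also have "\<dots> = d"
      proof -
        have "2 * (norm h + norm k + 1) > 0" by (auto simp: add_nonneg_pos)
        then show ?thesis unfolding t_def by (simp del: distrib_left_numeral)
      qed
      finally show ?thesis .
    qed
    have "x + a *\<^sub>R h + b *\<^sub>R k \<in> W" if "0 \<le> a" "a \<le> t" "0 \<le> b" "b \<le> t" for a b
      using near[OF that] d d3 by (auto simp: dist_commute subset_iff)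
    then obtain a b where ab: "0 \<le> a" "a \<le> t" "0 \<le> b" "b \<le> t"
      "\<phi> (x + t *\<^sub>R h + t *\<^sub>R k) - \<phi> (x + t *\<^sub>R h) - (\<phi> (x + t *\<^sub>R k) - \<phi> x)
      = t * (t * (h \<bullet> (H (x + a *\<^sub>R h + b *\<^sub>R k) *v k)))"
      using second_difference[OF C2 t, of x h k] by blast
    have near': "dist (x + a *\<^sub>R k + b *\<^sub>R h) x < d" if "0 \<le> a" "a \<le> t" "0 \<le> b" "b \<le> t" for a b
      using near[OF that(3,4,1,2)] by (simp add: add_ac)
    then have "x + a *\<^sub>R k + b *\<^sub>R h \<in> W" if "0 \<le> a" "a \<le> t" "0 \<le> b" "b \<le> t" for a b
      using near'[OF that] d d3 by (auto simp: dist_commute subset_iff)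
    then obtain a' b' where ab': "0 \<le> a'" "a' \<le> t" "0 \<le> b'" "b' \<le> t"
      "\<phi> (x + t *\<^sub>R k + t *\<^sub>R h) - \<phi> (x + t *\<^sub>R k) - (\<phi> (x + t *\<^sub>R h) - \<phi> x)
      = t * (t * (k \<bullet> (H (x + a' *\<^sub>R k + b' *\<^sub>R h) *v h)))"
      using second_difference[OF C2 t, of x k h] by blast
    have e': "x + t *\<^sub>R k + t *\<^sub>R h = x + t *\<^sub>R h + t *\<^sub>R k" by (simp add: add_ac)
    have "t * (t * (h \<bullet> (H (x + a *\<^sub>R h + b *\<^sub>R k) *v k)))
        = t * (t * (k \<bullet> (H (x + a' *\<^sub>R k + b' *\<^sub>R h) *v h)))"
      unfolding ab(5)[symmetric] ab'(5)[symmetric] e' by simp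
    then have "h \<bullet> (H (x + a *\<^sub>R h + b *\<^sub>R k) *v k) = k \<bullet> (H (x + a' *\<^sub>R k + b' *\<^sub>R h) *v h)"
      using t by simp
    moreover have "\<bar>h \<bullet> (H (x + a *\<^sub>R h + b *\<^sub>R k) *v k) - h \<bullet> (H x *v k)\<bar> < e"
      using near[OF ab(1-4)] d by (intro d1) auto
    moreover have "\<bar>k \<bullet> (H (x + a' *\<^sub>R k + b' *\<^sub>R h) *v h) - k \<bullet> (H x *v h)\<bar> < e"
      using near'[OF ab'(1-4)] d by (intro d2) auto
    ultimately have "\<bar>h \<bullet> (H x *v k) - k \<bullet> (H x *v h)\<bar> < 2 * e" by linarith
    then show False by (simp add: e_def)
  qed
  have "H x $ i $ j = H x $ j $ i" for i j
  proof -
    have "axis p 1 \<bullet> (H x *v axis q 1) = H x $ p $ q" for p q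
      by (simp add: inner_axis' matrix_vector_mul_component inner_axis)
    then show ?thesis using sym[of "axis i 1" "axis j 1"] by simp
  qed
  then show ?thesis by (simp add: sym_matrices_def transpose_def vec_eq_iff)
qed

text \<open>Along the line in direction h the first derivative vanishes at 0; a negative second
  derivative would make it negative just to the right, and the function would drop below its
  minimum.\<close>

lemma C2_hessian_at_min:
  fixes \<phi> :: "real^'n \<Rightarrow> real"
  assumes C2: "has_C2_hessian_on W \<phi> g H" and W: "open W" "x \<in> W"
    and min: "\<And>y. y \<in> W \<Longrightarrow> \<phi> x \<le> \<phi> y"
  shows "0 \<le> h \<bullet> (H x *v h)"
proof (rule ccontr)
  assume neg: "\<not> ?thesis"
  have g: "GDERIV \<phi> y :> g y" and H: "(g has_derivative (\<lambda>h. H y *v h)) (at y)"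
    if "y \<in> W" for y
    using C2 that by (auto simp: has_C2_hessian_on_def)
  have "open ((\<lambda>t. x + t *\<^sub>R h) -` W)"
    using W by (intro open_vimage continuous_intros)
  moreover have "0 \<in> (\<lambda>t. x + t *\<^sub>R h) -` W" using W by simp
  ultimately obtain e where e: "0 < e" "ball 0 e \<subseteq> (\<lambda>t. x + t *\<^sub>R h) -` W"
    using open_contains_ball by blast
  have inW: "x + t *\<^sub>R h \<in> W" if "\<bar>t\<bar> < e" for t
    using e(2) that by (auto simp: subset_iff dist_real_def)
  have d1: "((\<lambda>t. \<phi> (x + t *\<^sub>R h)) has_real_derivative h \<bullet> g (x + t *\<^sub>R h)) (at t)"
    if "\<bar>t\<bar> < e" for t
    using inW[OF that] by (intro real_derivative_line g)
  have "\<forall>t. \<bar>0 - t\<bar> < e \<longrightarrow> \<phi> (x + 0 *\<^sub>R h) \<le> \<phi> (x + t *\<^sub>R h)"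
    using min inW by simp
  then have "h \<bullet> g (x + 0 *\<^sub>R h) = 0"
    using DERIV_local_min[OF d1[of 0] e(1)] e(1) by simp
  moreover have d2: "((\<lambda>t. h \<bullet> g (x + t *\<^sub>R h)) has_real_derivative h \<bullet> (H x *v h)) (at 0)"
    using H[OF W(2)] by (intro real_derivative_line_inner) simp
  obtain d where d: "0 < d"
    "\<And>t. 0 < t \<Longrightarrow> t < d \<Longrightarrow> h \<bullet> g (x + (0 + t) *\<^sub>R h) < h \<bullet> g (x + 0 *\<^sub>R h)"
    using DERIV_neg_dec_right[OF d2] neg by auto
  define s where "s = min d e / 2"
  have s: "0 < s" "s < d" "s < e" using d(1) e(1) by (auto simp: s_def)
  have "\<phi> (x + s *\<^sub>R h) < \<phi> (x + 0 *\<^sub>R h)"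
  proof (rule DERIV_neg_imp_decreasing_open[OF s(1), where f="\<lambda>t. \<phi> (x + t *\<^sub>R h)"])
    show "\<exists>D. ((\<lambda>t. \<phi> (x + t *\<^sub>R h)) has_real_derivative D) (at t) \<and> D < 0" if "0 < t" "t < s" for t
      using d1[of t] d(2)[of t] that s calculation by (intro exI conjI) auto
    have "isCont (\<lambda>t. \<phi> (x + t *\<^sub>R h)) t" if "t \<in> {0..s}" for t
      using d1[of t] that s by (intro DERIV_isCont) auto
    then show "continuous_on {0..s} (\<lambda>t. \<phi> (x + t *\<^sub>R h))"
      by (simp add: continuous_at_imp_continuous_on)
  qed
  moreover have "\<phi> x \<le> \<phi> (x + s *\<^sub>R h)" using s by (intro min inW) auto
  ultimately show False by simp
qed

section \<open>From classical to viscosity inequalities\<close>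

lemma trace_pos_semidef_nonneg:
  assumes "pos_semidef M"
  shows "0 \<le> trace M"
  unfolding trace_def
proof (rule sum_nonneg)
  fix i :: 'a
  have "0 \<le> axis i 1 \<bullet> (M *v axis i 1)" using assms by (simp add: pos_semidef_def)
  then show "0 \<le> M $ i $ i"
    by (simp add: inner_axis' matrix_vector_mul_component inner_axis)
qed

lemma elliptic_mono:
  assumes "uniformly_elliptic lam Lam F" "0 \<le> lam"
    and M: "M \<in> sym_matrices" "M' \<in> sym_matrices"
    and "\<And>h. 0 \<le> h \<bullet> ((M' - M) *v h)"
  shows "F M \<le> F M'"
proof -
  have "transpose (M' - M) = M' - M"
    using M by (simp add: sym_matrices_def transpose_def vec_eq_iff)
  then have "pos_semidef (M' - M)" using assms(5) by (simp add: pos_semidef_def sym_matrices_def)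
  then have "lam * trace (M' - M) \<le> F (M + (M' - M)) - F M" "0 \<le> trace (M' - M)"
    using assms(1) M(1) trace_pos_semidef_nonneg unfolding uniformly_elliptic_def by blast+
  moreover have "0 \<le> lam * trace (M' - M)" using calculation assms(2) by simp
  ultimately show ?thesis by simp
qed

text \<open>Where a test function touches from below, its Hessian is dominated by that of u, and F
  is monotone.\<close>

lemma classical_imp_viscosity_supersolution:
  assumes F: "uniformly_elliptic lam Lam F" "0 \<le> lam" and U: "open U"
    and C2: "has_C2_hessian_on U u g H"
    and eq: "\<And>x. x \<in> U \<Longrightarrow> F (H x) + V x * u x \<le> 0"
  shows "viscosity_supersolution F V U u"
  unfolding viscosity_supersolution_def
proof (intro allI impI)
  fix x0 W \<phi> g' H'
  assume W: "open W" "x0 \<in> W" "W \<subseteq> U" "has_C2_hessian_on W \<phi> g' H'"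
    and min: "\<forall>x\<in>W. u x0 - \<phi> x0 \<le> u x - \<phi> x"
  have uW: "has_C2_hessian_on W u g H" by (rule has_C2_hessian_on_subset[OF C2 W(3)])
  have "F (H' x0) \<le> F (H x0)"
    using C2_hessian_symmetric[OF W(4,1,2)] C2_hessian_symmetric[OF uW W(1,2)]
      C2_hessian_at_min[OF has_C2_hessian_on_diff[OF uW W(4)] W(1,2)] min
    by (intro elliptic_mono[OF F]) auto
  then show "F (H' x0) + V x0 * u x0 \<le> 0" using eq[of x0] W by auto
qed

lemma classical_imp_viscosity_subsolution:
  assumes F: "uniformly_elliptic lam Lam F" "0 \<le> lam" and U: "open U"
    and C2: "has_C2_hessian_on U u g H"
    and eq: "\<And>x. x \<in> U \<Longrightarrow> 0 \<le> F (H x) + V x * u x"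
  shows "viscosity_subsolution F V U u"
  unfolding viscosity_subsolution_def
proof (intro allI impI)
  fix x0 W \<phi> g' H'
  assume W: "open W" "x0 \<in> W" "W \<subseteq> U" "has_C2_hessian_on W \<phi> g' H'"
    and max: "\<forall>x\<in>W. u x - \<phi> x \<le> u x0 - \<phi> x0"
  have uW: "has_C2_hessian_on W u g H" by (rule has_C2_hessian_on_subset[OF C2 W(3)])
  have "\<phi> x0 - u x0 \<le> \<phi> y - u y" if "y \<in> W" for y using max that by force
  then have "F (H x0) \<le> F (H' x0)"
    using C2_hessian_symmetric[OF W(4,1,2)] C2_hessian_symmetric[OF uW W(1,2)]
      C2_hessian_at_min[OF has_C2_hessian_on_diff[OF W(4) uW] W(1,2)]
    by (intro elliptic_mono[OF F]) auto
  then show "F (H' x0) + V x0 * u x0 \<ge> 0" using eq[of x0] W by force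
qed

section \<open>Upper and lower bounds for the principal eigenvalue\<close>

text \<open>A multiple of the subsolution \<open>\<phi>\<close> touches every positive supersolution from below, and
  being of class \<open>C\<^sup>2\<close> it is itself an admissible test function.\<close>
lemma principal_eigenvalue_le:
  fixes F :: "real^'n^'n \<Rightarrow> real"
  assumes hom: "positively_homogeneous F"
    and W: "open W" "W \<subseteq> K" and K: "compact K" "K \<subseteq> \<Omega>"
    and C2: "has_C2_hessian_on W \<phi> g H" and \<phi>c: "continuous_on K \<phi>"
    and bdry: "\<And>x. x \<in> K - W \<Longrightarrow> \<phi> x \<le> 0" and x1: "x1 \<in> K" "0 < \<phi> x1"
    and f: "\<And>x. x \<in> W \<Longrightarrow> 0 \<le> f x"
    and sub: "\<And>x. x \<in> W \<Longrightarrow> 0 < \<phi> x \<Longrightarrow> 0 < F (H x) + \<mu> * f x * \<phi> x"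
  shows "principal_eigenvalue F f \<Omega> \<le> ereal \<mu>"
  unfolding principal_eigenvalue_def
proof (rule Sup_least, clarsimp)
  fix \<nu> w
  assume wc: "continuous_on \<Omega> w" and wpos: "\<forall>x\<in>\<Omega>. 0 < w x"
    and visc: "viscosity_supersolution F (\<lambda>x. \<nu> * f x) \<Omega> w"
  show "\<nu> \<le> \<mu>"
  proof (rule ccontr)
    assume "\<not> \<nu> \<le> \<mu>"
    have wK: "0 < w x" if "x \<in> K" for x using wpos K that by auto
    have "continuous_on K (\<lambda>x. \<phi> x / w x)"
      using wK by (intro continuous_intros \<phi>c continuous_on_subset[OF wc K(2)]) force
    \<comment> \<open>The maximal ratio is positive because of \<open>x1\<close>, so it is attained
      where \<phi> > 0, hence inside the open set \<open>W\<close>.\<close>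
    from continuous_attains_sup[OF K(1) _ this] x1(1)
    obtain x0 where x0: "x0 \<in> K" "\<And>y. y \<in> K \<Longrightarrow> \<phi> y / w y \<le> \<phi> x0 / w x0" by blast
    define t where "t = \<phi> x0 / w x0"
    have "0 < \<phi> x1 / w x1" using x1 wK by simp
    then have t: "0 < t" using x0(2)[OF x1(1)] by (simp add: t_def)
    then have pos: "0 < \<phi> x0" using wK[OF x0(1)] by (simp add: t_def zero_less_divide_iff)
    then have x0W: "x0 \<in> W" using bdry[of x0] x0(1) by force
    have w0: "w x0 = inverse t * \<phi> x0" using pos by (simp add: t_def)
    have "inverse t * \<phi> x \<le> w x" if "x \<in> W" for x
    proof -
      have "x \<in> K" using that W by auto
      then have "\<phi> x \<le> t * w x" using x0(2)[of x] wK[of x] by (simp add: t_def pos_divide_le_eq)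
      then show ?thesis using t by (simp add: field_simps)
    qed
    then have "\<forall>x\<in>W. w x0 - inverse t * \<phi> x0 \<le> w x - inverse t * \<phi> x" using w0 by simp
    with visc W K x0W has_C2_hessian_on_scaleR[OF C2, of "inverse t"]
    have "F (inverse t *\<^sub>R H x0) + \<nu> * f x0 * w x0 \<le> 0"
      unfolding viscosity_supersolution_def by (meson order_trans)
    moreover have "F (inverse t *\<^sub>R H x0) = inverse t * F (H x0)"
      using hom t C2_hessian_symmetric[OF C2 W(1) x0W] by (simp add: positively_homogeneous_def)
    ultimately have "inverse t * (F (H x0) + \<nu> * f x0 * \<phi> x0) \<le> 0"
      by (simp add: w0 algebra_simps)
    then have "F (H x0) + \<nu> * f x0 * \<phi> x0 \<le> 0" using t by (simp add: mult_le_0_iff)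
    moreover have "\<mu> * f x0 * \<phi> x0 \<le> \<nu> * f x0 * \<phi> x0"
      using \<open>\<not> \<nu> \<le> \<mu>\<close> f[OF x0W] pos by (intro mult_right_mono) auto
    ultimately show False using sub[OF x0W pos] by simp
  qed
qed

lemma principal_eigenvalue_ge:
  assumes "continuous_on \<Omega> u" "\<And>x. x \<in> \<Omega> \<Longrightarrow> 0 < u x"
    "viscosity_supersolution F (\<lambda>x. \<mu> * f x) \<Omega> u"
  shows "ereal \<mu> \<le> principal_eigenvalue F f \<Omega>"
  unfolding principal_eigenvalue_def using assms by (intro Sup_upper) blast

lemma principal_eigenvalue_antimono:
  assumes "\<Omega>' \<subseteq> \<Omega>"
  shows "principal_eigenvalue F f \<Omega> \<le> principal_eigenvalue F f \<Omega>'"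
  unfolding principal_eigenvalue_def
proof (intro Sup_subset_mono image_mono Collect_mono impI, elim exE conjE)
  fix \<mu> u
  assume u: "continuous_on \<Omega> u" "\<forall>x\<in>\<Omega>. 0 < u x"
    "viscosity_supersolution F (\<lambda>x. \<mu> * f x) \<Omega> u"
  have "viscosity_supersolution F (\<lambda>x. \<mu> * f x) \<Omega>' u"
    using u(3) order_trans[OF _ assms] unfolding viscosity_supersolution_def by blast
  then show "\<exists>u. continuous_on \<Omega>' u \<and> (\<forall>x\<in>\<Omega>'. 0 < u x) \<and>
      viscosity_supersolution F (\<lambda>x. \<mu> * f x) \<Omega>' u"
    using u(1,2) assms continuous_on_subset by blast
qed

section \<open>Radial Hessians\<close>

definition outer :: "real^'n \<Rightarrow> real^'n^'n" where
  "outer x = (\<chi> i j. x $ i * x $ j)"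

text \<open>For a unit vector x: eigenvalue \<open>a\<close> on the line of x and \<open>b\<close>
  on its orthogonal complement.\<close>

definition radial_matrix :: "real \<Rightarrow> real \<Rightarrow> real^'n \<Rightarrow> real^'n^'n" where
  "radial_matrix a b x = b *\<^sub>R mat 1 + (a - b) *\<^sub>R outer x"

lemma outer_mult_vec: "outer x *v h = (x \<bullet> h) *\<^sub>R x"
  by (simp add: outer_def matrix_vector_mult_def vec_eq_iff inner_vec_def
      sum_distrib_left mult_ac)

lemma radial_matrix_mult_vec:
  "radial_matrix a b x *v h = b *\<^sub>R h + ((a - b) * (x \<bullet> h)) *\<^sub>R x"
  by (simp add: radial_matrix_def matrix_vector_mult_add_rdistrib outer_mult_vec
      scaleR_matrix_vector_assoc[symmetric])

lemma outer_symmetric: "outer x \<in> sym_matrices"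
  by (simp add: sym_matrices_def outer_def transpose_def vec_eq_iff mult.commute)

lemma radial_matrix_symmetric: "radial_matrix a b x \<in> sym_matrices"
  by (simp add: sym_matrices_def radial_matrix_def outer_def transpose_def vec_eq_iff mat_def
      mult.commute)

lemma trace_outer: "trace (outer x) = (norm x)\<^sup>2"
  by (simp add: trace_def outer_def power2_norm_eq_inner inner_vec_def)

lemma pos_semidef_outer: "pos_semidef (outer x)"
  by (simp add: pos_semidef_def outer_symmetric outer_mult_vec inner_commute)

lemma pos_semidef_complement:
  assumes "norm e = 1"
  shows "pos_semidef (mat 1 - outer e)"
proof -
  have "(e \<bullet> x)\<^sup>2 \<le> x \<bullet> x" for x
    using Cauchy_Schwarz_ineq[of e x] assms by (simp add: dot_square_norm)
  moreover have "mat 1 - outer e \<in> sym_matrices"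
    by (simp add: sym_matrices_def outer_def transpose_def vec_eq_iff mat_def mult.commute)
  ultimately show ?thesis
    by (simp add: pos_semidef_def matrix_vector_mult_diff_rdistrib outer_mult_vec
        inner_diff_right inner_commute power2_eq_square)
qed

lemma trace_scaleR: "trace (c *\<^sub>R A :: real^'n^'n) = c * trace A"
  by (simp add: trace_def sum_distrib_left)

lemma pos_semidef_scaleR: "pos_semidef M \<Longrightarrow> 0 \<le> t \<Longrightarrow> pos_semidef (t *\<^sub>R M)"
  by (auto simp: pos_semidef_def sym_matrices_def transpose_scalar scaleR_matrix_vector_assoc[symmetric])

section \<open>Reduction of the operator to a scalar profile\<close>

lemma conjugate_radial_matrix:
  fixes Q :: "real^'n^'n"
  assumes "orthogonal_matrix Q"
  shows "transpose Q ** radial_matrix a b x ** Q = radial_matrix a b (transpose Q *v x)"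
proof -
  have Q: "transpose Q *v (Q *v h) = h" for h
    using assms by (simp add: orthogonal_matrix matrix_vector_mul_assoc del: transpose_matrix_vector)
  have i: "x \<bullet> (Q *v h) = (transpose Q *v x) \<bullet> h" for h
    by (simp add: dot_lmul_matrix)
  have "(transpose Q ** radial_matrix a b x ** Q) *v h = radial_matrix a b (transpose Q *v x) *v h"
    for h
    by (simp add: matrix_vector_mul_assoc[symmetric] radial_matrix_mult_vec
        matrix_vector_right_distrib matrix_vector_mult_scaleR Q i del: transpose_matrix_vector)
  then show ?thesis by (simp add: matrix_eq)
qed

text \<open>\<open>axis undefined 1\<close> is just some unit vector; rotational invariance makes
  the value independent of it (\<open>radial_profile_eq\<close>).\<close>

definition radial_profile :: "(real^'n^'n \<Rightarrow> real) \<Rightarrow> real \<Rightarrow> real \<Rightarrow> real" where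
  "radial_profile F a b = F (radial_matrix a b (axis undefined 1))"

lemma radial_profile_eq:
  fixes F :: "real^'n^'n \<Rightarrow> real"
  assumes "rotationally_invariant F" "norm e = 1"
  shows "F (radial_matrix a b e) = radial_profile F a b"
proof -
  obtain Q :: "real^'n^'n" where Q: "orthogonal_matrix Q" "Q *v axis undefined 1 = e"
    using orthogonal_matrix_exists_basis[OF assms(2)] by blast
  have "transpose Q *v e = axis undefined 1"
    using Q by (simp add: orthogonal_matrix matrix_vector_mul_assoc Q(2)[symmetric]
        del: transpose_matrix_vector)
  then have "transpose Q ** radial_matrix a b e ** Q = radial_matrix a b (axis undefined 1)"
    using conjugate_radial_matrix[OF Q(1)] by simp
  then show ?thesis
    using assms(1) Q(1) radial_matrix_symmetric[of a b e]
    by (simp add: rotationally_invariant_def radial_profile_def) metis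
qed

text \<open>Raising \<open>a\<close> adds a multiple of \<open>outer e\<close>, of trace 1; raising
  \<open>b\<close> adds a multiple of the complementary projection, of trace N - 1. Ellipticity is
  read off along these two directions.\<close>

lemma radial_operator_profile:
  fixes F :: "real^'n^'n \<Rightarrow> real"
  assumes lam: "0 < lam" "lam \<le> Lam" and dim: "lam / Lam * (real CARD('n) - 1) + 1 > 2"
    and ell: "uniformly_elliptic lam Lam F" and hom: "positively_homogeneous F"
  shows "radial_operator (radial_profile F) lam Lam (real CARD('n) - 1)"
proof -
  define e :: "real^'n" where "e = axis undefined 1"
  have e: "norm e = 1" by (simp add: e_def)
  note P = radial_profile_def[of F, folded e_def]
  have 1: "radial_matrix (a + t) b e = radial_matrix a b e + t *\<^sub>R outer e" for a b t
    by (simp add: radial_matrix_def algebra_simps)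
  have 2: "radial_matrix a (b + t) e = radial_matrix a b e + t *\<^sub>R (mat 1 - outer e)" for a b t
    by (simp add: radial_matrix_def algebra_simps)
  have 3: "radial_matrix (t * a) (t * b) e = t *\<^sub>R radial_matrix a b e" for a b t
    by (simp add: radial_matrix_def algebra_simps)
  have bounds: "lam * (t * trace M') \<le> F (radial_matrix a b e + t *\<^sub>R M') - F (radial_matrix a b e)"
    "F (radial_matrix a b e + t *\<^sub>R M') - F (radial_matrix a b e) \<le> Lam * (t * trace M')"
    if "0 \<le> t" "pos_semidef M'" for a b t M'
    unfolding trace_scaleR[symmetric, of t]
    using ell radial_matrix_symmetric[of a b e] pos_semidef_scaleR[OF that(2,1)]
    by (auto simp: uniformly_elliptic_def)
  have tr: "trace (outer e) = 1" "trace (mat 1 - outer e) = real CARD('n) - 1"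
    using e by (simp_all add: trace_sub trace_I trace_outer)
  have "0 < Lam" using lam by simp
  with dim have d: "Lam < lam * (real CARD('n) - 1)" by (simp add: field_simps)
  show ?thesis
  proof
    show "0 < lam" "lam \<le> Lam" "Lam < lam * (real CARD('n) - 1)" by fact+
    fix t a b :: real
    show "0 \<le> t \<Longrightarrow> lam * t \<le> radial_profile F (a + t) b - radial_profile F a b"
      "0 \<le> t \<Longrightarrow> radial_profile F (a + t) b - radial_profile F a b \<le> Lam * t"
      using bounds[of t "outer e" a b] pos_semidef_outer[of e] by (simp_all add: P 1 tr)
    show "0 \<le> t \<Longrightarrow> lam * (real CARD('n) - 1) * t \<le> radial_profile F a (b + t) - radial_profile F a b"
      "0 \<le> t \<Longrightarrow> radial_profile F a (b + t) - radial_profile F a b \<le> Lam * (real CARD('n) - 1) * t"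
      using bounds[of t "mat 1 - outer e" a b] pos_semidef_complement[OF e]
      by (simp_all add: P 2 tr mult_ac)
    show "0 < t \<Longrightarrow> radial_profile F (t * a) (t * b) = t * radial_profile F a b"
      using hom radial_matrix_symmetric[of a b e] by (simp add: positively_homogeneous_def P 3)
  qed
qed

lemma radial_has_C2_hessian:
  fixes I :: "real set"
  assumes I: "\<And>r. r \<in> I \<Longrightarrow> 0 < r"
    and p: "\<And>r. r \<in> I \<Longrightarrow> (p has_real_derivative p1 r) (at r)"
    and p1: "\<And>r. r \<in> I \<Longrightarrow> (p1 has_real_derivative p2 r) (at r)"
    and p2: "continuous_on I p2"
  shows "has_C2_hessian_on {x::real^'n. norm x \<in> I} (\<lambda>x. p (norm x))
    (\<lambda>x. (p1 (norm x) / norm x) *\<^sub>R x)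
    (\<lambda>x. radial_matrix (p2 (norm x)) (p1 (norm x) / norm x) (x /\<^sub>R norm x))"
  unfolding has_C2_hessian_on_def
proof (intro conjI ballI)
  fix x :: "real^'n" assume "x \<in> {x. norm x \<in> I}"
  then have x: "norm x \<in> I" "x \<noteq> 0" using I[of "norm x"] by auto
  show "GDERIV (\<lambda>x. p (norm x)) x :> (p1 (norm x) / norm x) *\<^sub>R x"
    using GDERIV_DERIV_compose[OF GDERIV_norm[OF x(2)] p[OF x(1)]]
    by (simp add: sgn_div_norm divide_inverse)
  define r where "r = norm x"
  have r: "0 < r" using x(2) by (simp add: r_def)
  have "((\<lambda>r. p1 r / r) has_real_derivative (p2 r * r - p1 r * 1) / (r * r)) (at r)"
    using p1[of r] x r by (intro DERIV_divide DERIV_ident) (auto simp: r_def)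
  then have d: "((\<lambda>x. p1 (norm x) / norm x) has_derivative
      (\<lambda>h. h \<bullet> (((p2 r * r - p1 r * 1) / (r * r)) *\<^sub>R sgn x))) (at x)"
    using GDERIV_DERIV_compose[OF GDERIV_norm[OF x(2)], of "\<lambda>r. p1 r / r"]
    unfolding r_def gderiv_def by blast
  have "((\<lambda>x. (p1 (norm x) / norm x) *\<^sub>R x) has_derivative
      (\<lambda>h. (p1 (norm x) / norm x) *\<^sub>R h +
        (h \<bullet> (((p2 r * r - p1 r * 1) / (r * r)) *\<^sub>R sgn x)) *\<^sub>R x)) (at x)"
    by (rule has_derivative_scaleR[OF d has_derivative_ident])
  moreover have "(\<lambda>h. (p1 (norm x) / norm x) *\<^sub>R h +
        (h \<bullet> (((p2 r * r - p1 r * 1) / (r * r)) *\<^sub>R sgn x)) *\<^sub>R x) =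
      (\<lambda>h. radial_matrix (p2 (norm x)) (p1 (norm x) / norm x) (x /\<^sub>R norm x) *v h)"
  proof
    fix h
    have "(p2 r * r - p1 r * 1) / (r * r) * (inverse r * (x \<bullet> h))
        = (p2 r - p1 r / r) * (inverse r * (x \<bullet> h)) * inverse r"
      using r by (simp add: field_simps)
    then show "(p1 (norm x) / norm x) *\<^sub>R h +
        (h \<bullet> (((p2 r * r - p1 r * 1) / (r * r)) *\<^sub>R sgn x)) *\<^sub>R x =
      radial_matrix (p2 (norm x)) (p1 (norm x) / norm x) (x /\<^sub>R norm x) *v h"
      by (simp add: radial_matrix_mult_vec sgn_div_norm r_def inner_commute)
  qed
  ultimately show "((\<lambda>x. (p1 (norm x) / norm x) *\<^sub>R x) has_derivative
      (\<lambda>h. radial_matrix (p2 (norm x)) (p1 (norm x) / norm x) (x /\<^sub>R norm x) *v h)) (at x)"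
    by (simp only:)
next
  have "continuous_on I p1"
    using p1 by (intro continuous_at_imp_continuous_on ballI DERIV_isCont) blast
  then have c: "continuous_on {x::real^'n. norm x \<in> I} (\<lambda>x. p1 (norm x))"
    by (rule continuous_on_compose2) (auto intro: continuous_intros)
  have c2: "continuous_on {x::real^'n. norm x \<in> I} (\<lambda>x. p2 (norm x))"
    by (rule continuous_on_compose2[OF p2]) (auto intro: continuous_intros)
  have "continuous_on {x::real^'n. norm x \<in> I} (\<lambda>x. outer (x /\<^sub>R norm x))"
    unfolding outer_def using I by (intro continuous_intros) force+
  with c c2 show "continuous_on {x::real^'n. norm x \<in> I}
      (\<lambda>x. radial_matrix (p2 (norm x)) (p1 (norm x) / norm x) (x /\<^sub>R norm x))"
    unfolding radial_matrix_def using I by (intro continuous_intros) force+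
qed

section \<open>The radial eigenfunction\<close>

context radial_operator
begin

lemma radial_eigenprofile:
  assumes \<gamma>: "0 < \<gamma>" "\<gamma> < 2"
  obtains \<mu> C c p p1 p2 where "0 < \<mu>" "0 < C" "0 < c"
    "continuous_on {0..} p" "p 0 = 1" "p 1 = 0" "\<And>r. 0 \<le> r \<Longrightarrow> r < 1 \<Longrightarrow> 0 < p r"
    "\<And>r. 0 < r \<Longrightarrow> (p has_real_derivative p1 r) (at r)"
    "\<And>r. 0 < r \<Longrightarrow> (p1 has_real_derivative p2 r) (at r)"
    "continuous_on {0<..} p2"
    "\<And>r. 0 < r \<Longrightarrow> Phi (p2 r) (p1 r / r) = - (\<mu> * r powr (- \<gamma>) * p r)"
    "\<And>r. 0 < r \<Longrightarrow> r \<le> 1 \<Longrightarrow> p1 r < 0"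
    "\<And>r t. 0 \<le> r \<Longrightarrow> r \<le> 1 \<Longrightarrow> 0 \<le> t \<Longrightarrow> t \<le> 1 \<Longrightarrow>
      \<bar>p r - p t\<bar> \<le> C * \<bar>r powr (2 - \<gamma>) - t powr (2 - \<gamma>)\<bar>"
    "\<And>r. 0 \<le> r \<Longrightarrow> r \<le> 1 \<Longrightarrow> p r \<le> 1 - c * r powr (2 - \<gamma>)"
    "\<And>r. 0 < r \<Longrightarrow> r \<le> 1 \<Longrightarrow> \<bar>p1 r\<bar> \<le> C * r powr (1 - \<gamma>)"
proof -
  define b where "b = 2 - \<gamma>"
  have b: "0 < b" using \<gamma> by (simp add: b_def)
  show ?thesis
  proof (rule radial_eigenfunction[OF b])
    fix S y v
    assume S: "0 < S" and yc: "continuous_on UNIV y" and vc: "continuous_on UNIV v"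
      and v0: "v 0 = 1" and vS: "v S = 0" and vpos: "\<And>s. 0 \<le> s \<Longrightarrow> s < S \<Longrightarrow> 0 < v s"
      and yneg: "\<And>s. 0 \<le> s \<Longrightarrow> s \<le> S \<Longrightarrow> y s < 0"
      and vd: "\<And>s. 0 < s \<Longrightarrow> (v has_real_derivative y s / b) (at s)"
      and yd: "\<And>s. 0 < s \<Longrightarrow>
        (y has_real_derivative ((y s + G (y s) (- v s)) / b - y s) / s) (at s)"
    have yc': "continuous_on {0..S} y" by (rule continuous_on_subset[OF yc]) simp
    obtain sM where sM: "sM \<in> {0..S}" "\<And>s. s \<in> {0..S} \<Longrightarrow> y s \<le> y sM"
      using continuous_attains_sup[OF compact_Icc _ yc'] S by auto
    obtain sm where sm: "sm \<in> {0..S}" "\<And>s. s \<in> {0..S} \<Longrightarrow> y sm \<le> y s"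
      using continuous_attains_inf[OF compact_Icc _ yc'] S by auto
    \<comment> \<open>On {0..S} the slope y / b of v lies between two negative constants by
      compactness. One of them bounds the variation of p, the other produces the cusp at the
      origin.\<close>
    have slope: "\<exists>l. y sm \<le> l \<and> l \<le> y sM \<and> v t - v s = (t - s) * l / b"
      if "0 \<le> s" "s < t" "t \<le> S" for s t
    proof -
      have "\<exists>l z. s < z \<and> z < t \<and> (v has_real_derivative l) (at z) \<and> v t - v s = (t - s) * l"
      proof (rule MVT)
        show "v differentiable at x" if "s < x" "x < t" for x
          using vd[of x] that \<open>0 \<le> s\<close> real_differentiable_def by auto
      qed (use that vc continuous_on_subset in auto)
      then obtain l z where z: "s < z" "z < t" "(v has_real_derivative l) (at z)"
        "v t - v s = (t - s) * l" by blast
      have "l = y z / b" using DERIV_unique[OF z(3) vd[of z]] z(1) that by simp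
      then show ?thesis using z sM(2)[of z] sm(2)[of z] that by (intro exI[of _ "y z"]) auto
    qed
    \<comment> \<open>The factor S moves the first zero of v to r = 1. By homogeneity of
      \<open>Phi\<close> it reappears in front of r powr (- \<gamma>), so S is the
      eigenvalue.\<close>
    define \<sigma> where "\<sigma> = (\<lambda>r. S * r powr b)"
    have \<sigma>0: "0 < \<sigma> r" if "0 < r" for r using S that by (simp add: \<sigma>_def)
    have \<sigma>1: "0 \<le> \<sigma> r" "\<sigma> r \<le> S" if "0 \<le> r" "r \<le> 1" for r
      using S that b powr_mono2[of b r 1] by (auto simp: \<sigma>_def)
    have \<sigma>2: "\<sigma> r < S" if "0 \<le> r" "r < 1" for r
      using S that b powr_less_mono2[of b r 1] by (auto simp: \<sigma>_def)
    have \<sigma>d: "(\<sigma> has_real_derivative b * \<sigma> r / r) (at r)" if "0 < r" for r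
      unfolding \<sigma>_def using that
      by (auto intro!: derivative_eq_intros simp: powr_diff)
    define p where "p = (\<lambda>r. v (\<sigma> r))"
    define p1 where "p1 = (\<lambda>r. \<sigma> r * y (\<sigma> r) / r)"
    define p2 where "p2 = (\<lambda>r. \<sigma> r * G (y (\<sigma> r)) (- v (\<sigma> r)) / (r * r))"
    \<comment> \<open>The first summand bounds differences of p, the second bounds
      \<open>p1\<close>; their sum serves both.\<close>
    define C where "C = - y sm * S / b + - y sm * S"
    define c where "c = - y sM * S / b"
    have ym: "y sm < 0" "y sM < 0" using yneg sm(1) sM(1) by auto
    have Cc: "0 < C" "0 < c" "- y sm * S / b \<le> C" "- y sm * S \<le> C"
    proof -
      have "y sm * S < 0" "y sM * S < 0" using ym S by (auto simp: mult_neg_pos)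
      moreover from this have "y sm * S / b < 0" "y sM * S / b < 0" using b by (auto simp: divide_neg_pos)
      ultimately show "0 < C" "0 < c" "- y sm * S / b \<le> C" "- y sm * S \<le> C"
        by (simp_all add: C_def c_def)
    qed
    have \<sigma>c: "continuous_on {0..} \<sigma>"
      unfolding \<sigma>_def using b by (intro continuous_intros continuous_on_powr') auto
    have pd: "(p has_real_derivative p1 r) (at r)" if r: "0 < r" for r
    proof -
      have "(p has_real_derivative y (\<sigma> r) / b * (b * \<sigma> r / r)) (at r)"
        unfolding p_def by (rule DERIV_chain2[OF vd \<sigma>d]) (use r \<sigma>0 in auto)
      then show ?thesis using b by (simp add: p1_def mult.commute)
    qed
    have p1d: "(p1 has_real_derivative p2 r) (at r)" if r: "0 < r" for r
    proof -
      define s where "s = \<sigma> r"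
      have s: "0 < s" using \<sigma>0 r by (simp add: s_def)
      define D where "D = (y s + G (y s) (- v s)) / b"
      have "((\<lambda>r. y (\<sigma> r)) has_real_derivative (D - y s) / s * (b * s / r)) (at r)"
        unfolding D_def s_def by (rule DERIV_chain2[OF yd \<sigma>d]) (use r \<sigma>0 in auto)
      then have "(p1 has_real_derivative
          ((b * s / r * y s + (D - y s) / s * (b * s / r) * s) * r - s * y s * 1) / (r * r)) (at r)"
        unfolding p1_def s_def using r
        by (intro DERIV_divide DERIV_mult \<sigma>d DERIV_ident) auto
      moreover have "((b * s / r * y s + (D - y s) / s * (b * s / r) * s) * r - s * y s * 1)
          = s * (b * D - y s)"
        using s r by (simp add: field_simps)
      moreover have "b * D - y s = G (y s) (- v s)" using b by (simp add: D_def)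
      ultimately show ?thesis by (simp add: p2_def s_def)
    qed
    have lip: "\<bar>v s - v t\<bar> \<le> - y sm / b * \<bar>s - t\<bar>" if "0 \<le> s" "s \<le> S" "0 \<le> t" "t \<le> S" for s t
    proof -
      have *: "\<bar>v t - v s\<bar> \<le> - y sm / b * \<bar>t - s\<bar>" if "0 \<le> s" "s < t" "t \<le> S" for s t
      proof -
        obtain l where l: "y sm \<le> l" "l \<le> y sM" "v t - v s = (t - s) * l / b"
          using slope[OF \<open>0 \<le> s\<close> \<open>s < t\<close> \<open>t \<le> S\<close>] by blast
        have "\<bar>v t - v s\<bar> = (- l) * ((t - s) / b)"
          unfolding l(3) using that b l(2) ym by (simp add: abs_mult abs_of_neg)
        also have "\<dots> \<le> (- y sm) * ((t - s) / b)"
          using l that b by (intro mult_right_mono) auto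
        finally show ?thesis using that by simp
      qed
      show ?thesis using *[of s t] *[of t s] that
        by (cases s t rule: linorder_cases) (auto simp: abs_minus_commute)
    qed
    show ?thesis
    proof (rule that[of S C c p p1 p2])
      show "0 < S" "0 < C" "0 < c" by fact+
      show "continuous_on {0..} p"
        unfolding p_def by (rule continuous_on_compose2[OF vc \<sigma>c]) simp
      show "p 0 = 1" "p 1 = 0" using b v0 vS by (simp_all add: p_def \<sigma>_def)
      show "0 < p r" if "0 \<le> r" "r < 1" for r
        unfolding p_def using that \<sigma>1[of r] \<sigma>2[of r] by (intro vpos) auto
      show "(p has_real_derivative p1 r) (at r)" "(p1 has_real_derivative p2 r) (at r)"
        if "0 < r" for r using pd p1d that by auto
      show "continuous_on {0<..} p2"
      proof -
        have sc: "continuous_on {0<..} \<sigma>" by (rule continuous_on_subset[OF \<sigma>c]) auto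
        have yv: "continuous_on {0<..} (\<lambda>r. y (\<sigma> r))" "continuous_on {0<..} (\<lambda>r. v (\<sigma> r))"
          by (auto intro: continuous_on_compose2[OF yc sc] continuous_on_compose2[OF vc sc])
        show ?thesis
          unfolding p2_def by (intro continuous_intros sc continuous_on_G yv) auto
      qed
      show "Phi (p2 r) (p1 r / r) = - (S * r powr (- \<gamma>) * p r)" if r: "0 < r" for r
      proof -
        have t: "0 < \<sigma> r / (r * r)" using \<sigma>0[OF r] r by simp
        have "Phi (p2 r) (p1 r / r) = \<sigma> r / (r * r) * Phi (G (y (\<sigma> r)) (- v (\<sigma> r))) (y (\<sigma> r))"
          using hom[OF t, of "G (y (\<sigma> r)) (- v (\<sigma> r))" "y (\<sigma> r)"] by (simp add: p1_def p2_def)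
        also have "\<dots> = - (\<sigma> r / (r * r) * p r)" by (simp add: Phi_G p_def)
        also have "\<sigma> r / (r * r) = S * r powr (- \<gamma>)"
          using r by (simp add: \<sigma>_def b_def powr_diff powr_minus power2_eq_square field_simps)
        finally show ?thesis .
      qed
      show "p1 r < 0" if "0 < r" "r \<le> 1" for r
        using yneg[of "\<sigma> r"] \<sigma>0[of r] \<sigma>1[of r] that
        by (simp add: p1_def divide_neg_pos mult_pos_neg)
      show "\<bar>p r - p t\<bar> \<le> C * \<bar>r powr (2 - \<gamma>) - t powr (2 - \<gamma>)\<bar>"
        if "0 \<le> r" "r \<le> 1" "0 \<le> t" "t \<le> 1" for r t
      proof -
        have "\<bar>p r - p t\<bar> \<le> - y sm / b * \<bar>\<sigma> r - \<sigma> t\<bar>"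
          unfolding p_def using \<sigma>1 that by (intro lip) auto
        also have "\<sigma> r - \<sigma> t = S * (r powr b - t powr b)" by (simp add: \<sigma>_def algebra_simps)
        also have "- y sm / b * \<bar>S * (r powr b - t powr b)\<bar> = - y sm * S / b * \<bar>r powr b - t powr b\<bar>"
          using S by (simp add: abs_mult)
        also have "\<dots> \<le> C * \<bar>r powr b - t powr b\<bar>" using Cc by (intro mult_right_mono) auto
        finally show ?thesis by (simp add: b_def)
      qed
      show "p r \<le> 1 - c * r powr (2 - \<gamma>)" if "0 \<le> r" "r \<le> 1" for r
      proof (cases "r = 0")
        case True
        then show ?thesis using v0 b by (simp add: p_def \<sigma>_def b_def)
      next
        case False
        then have r: "0 < \<sigma> r" "\<sigma> r \<le> S" using that \<sigma>0[of r] \<sigma>1[of r] by auto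
        then obtain l where l: "y sm \<le> l" "l \<le> y sM" "v (\<sigma> r) - v 0 = (\<sigma> r - 0) * l / b"
          using slope[of 0 "\<sigma> r"] by auto
        have "\<sigma> r * l / b \<le> \<sigma> r * y sM / b"
          using r b l by (intro divide_right_mono mult_left_mono) auto
        then show ?thesis using l(3) v0 by (simp add: p_def c_def b_def[symmetric] \<sigma>_def mult_ac)
      qed
      show "\<bar>p1 r\<bar> \<le> C * r powr (1 - \<gamma>)" if "0 < r" "r \<le> 1" for r
      proof -
        have y: "\<bar>y (\<sigma> r)\<bar> \<le> - y sm" using yneg[of "\<sigma> r"] sm(2)[of "\<sigma> r"] \<sigma>1[of r] that by auto
        have e: "r powr (1 - \<gamma>) = r powr b / r"
          using that powr_diff[of r b 1] by (simp add: b_def)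
        have "\<bar>p1 r\<bar> = \<sigma> r / r * \<bar>y (\<sigma> r)\<bar>"
          using \<sigma>0[of r] that by (simp add: p1_def abs_mult)
        also have "\<dots> \<le> \<sigma> r / r * (- y sm)"
          using \<sigma>0[of r] that y by (intro mult_left_mono) auto
        also have "\<dots> = - y sm * S * r powr (1 - \<gamma>)" unfolding e by (simp add: \<sigma>_def)
        also have "\<dots> \<le> C * r powr (1 - \<gamma>)" using Cc by (intro mult_right_mono) auto
        finally show ?thesis .
      qed
    qed
  qed
qed

end

section \<open>Barriers and the cusp at the origin\<close>

context radial_operator
begin

text \<open>The barrier is \<open>q = p + k p\<^sup>2 - \<epsilon> r powr (- \<alpha>)\<close>. The convex term \<open>k p\<^sup>2\<close> yields a positive
  multiple of \<open>p1\<^sup>2\<close>, which is what is needed near \<open>r = 1\<close>; the power, with \<open>0 < \<alpha> < \<lambda>n/\<Lambda> - 1\<close>,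
  is a strict supersolution for the maximal Pucci operator and makes \<open>q\<close> negative near
  \<open>r = 0\<close>.\<close>
lemma radial_barrier:
  assumes \<gamma>: "0 < \<gamma>" "\<gamma> < 2" and \<mu>: "0 < \<mu>" "\<mu> < \<mu>'"
    and p0: "p 1 = 0" "\<And>r. 0 \<le> r \<Longrightarrow> r < 1 \<Longrightarrow> 0 < p r" "\<And>r. 0 \<le> r \<Longrightarrow> r \<le> 1 \<Longrightarrow> p r \<le> 1"
    and pd: "\<And>r. 0 < r \<Longrightarrow> (p has_real_derivative p1 r) (at r)"
    and p1d: "\<And>r. 0 < r \<Longrightarrow> (p1 has_real_derivative p2 r) (at r)"
    and p2c: "continuous_on {0<..} p2"
    and eq: "\<And>r. 0 < r \<Longrightarrow> Phi (p2 r) (p1 r / r) = - (\<mu> * r powr (- \<gamma>) * p r)"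
    and neg: "\<And>r. 0 < r \<Longrightarrow> r \<le> 1 \<Longrightarrow> p1 r < 0"
  obtains \<delta> \<rho> r q q1 q2 where "0 < \<delta>" "\<delta> \<le> r" "r \<le> \<rho>" "\<rho> < 1" "q \<delta> \<le> 0" "q \<rho> \<le> 0" "0 < q r"
    "\<And>r. 0 < r \<Longrightarrow> (q has_real_derivative q1 r) (at r)"
    "\<And>r. 0 < r \<Longrightarrow> (q1 has_real_derivative q2 r) (at r)"
    "continuous_on {0<..} q2"
    "\<And>r. 0 < r \<Longrightarrow> r < 1 \<Longrightarrow> 0 < Phi (q2 r) (q1 r / r) + \<mu>' * r powr (- \<gamma>) * q r"
proof -
  \<comment> \<open>Half of the admissible range, so that lam n - Lam (\<alpha> + 1) equals \<alpha>
    Lam.\<close>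
  define \<alpha> where "\<alpha> = (lam * n / Lam - 1) / 2"
  \<comment> \<open>Equivalently \<mu>' = \<mu> (1 + 2 k). With p \<le> 1 this gives \<mu> (1 + 2 k
    p) \<le> \<mu>' (1 + k p): the change from p to p + k p^2 is paid for by the surplus \<mu>' -
    \<mu>.\<close>
  define k where "k = (\<mu>' - \<mu>) / (2 * \<mu>)"
  define A where "A = \<alpha> * \<alpha> * Lam"
  define b where "b = 2 - \<gamma>"
  have \<alpha>: "0 < \<alpha>" using slope_bounds by (simp add: \<alpha>_def)
  have k: "0 < k" using \<mu> by (simp add: k_def)
  have A: "0 < A" using \<alpha> Lam_pos by (simp add: A_def)
  have b: "0 < b" using \<gamma> by (simp add: b_def)
  have \<mu>': "0 < \<mu>'" using \<mu> by simp
  \<comment> \<open>The power term gains at least \<epsilon> A r powr (- \<alpha> - 2) through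
    \<open>Phi\<close> and costs \<epsilon> \<mu>' r powr (b - \<alpha> - 2) through the potential.
    Up to \<open>r0\<close> the gain covers the cost; beyond it the minimum \<open>m\<close> of the
    p1^2 term does.\<close>
  define r0 where "r0 = min 1 ((A / \<mu>') powr (1 / b))"
  have r0: "0 < r0" "r0 \<le> 1" using A \<mu>' by (auto simp: r0_def)
  have r0b: "\<mu>' * r powr b \<le> A" if "0 < r" "r \<le> r0" for r
  proof -
    have "r powr b \<le> ((A / \<mu>') powr (1 / b)) powr b"
      using that b by (intro powr_mono2) (auto simp: r0_def)
    also have "\<dots> = A / \<mu>'" using A \<mu>' b by (simp add: powr_powr)
    finally show ?thesis using \<mu>' by (simp add: field_simps)
  qed
  have "isCont p1 r" if "r \<in> {r0..1}" for r
    using p1d[of r] that r0 by (intro DERIV_isCont) auto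
  then have "continuous_on {r0..1} (\<lambda>r. (p1 r)\<^sup>2)"
    by (intro continuous_intros continuous_at_imp_continuous_on) auto
  then obtain rm where rm: "rm \<in> {r0..1}" "\<And>r. r \<in> {r0..1} \<Longrightarrow> (p1 rm)\<^sup>2 \<le> (p1 r)\<^sup>2"
    using continuous_attains_inf[of "{r0..1}" "\<lambda>r. (p1 r)\<^sup>2"] r0 by auto
  define m where "m = 2 * k * lam * (p1 rm)\<^sup>2"
  have "p1 rm \<noteq> 0" using neg[of rm] rm(1) r0 by auto
  then have m: "0 < m" using k lam_pos by (simp add: m_def)
  \<comment> \<open>The first bound keeps the cost of the power below \<open>m\<close> between
    \<open>r0\<close> and 1, the second keeps q positive at 1/2; the factors 2 give
    strictness.\<close>
  define \<epsilon> where "\<epsilon> = min (m / (2 * \<mu>' * r0 powr (- \<alpha> - 2))) (p (1/2) / (2 * (1/2) powr (- \<alpha>)))"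
  have "0 < m / (2 * \<mu>' * r0 powr (- \<alpha> - 2))" "0 < p (1/2) / (2 * (1/2) powr (- \<alpha>))"
    using m \<mu>' r0 p0(2)[of "1/2"] by auto
  then have \<epsilon>: "0 < \<epsilon>" by (simp add: \<epsilon>_def)
  have \<epsilon>1: "\<epsilon> * \<mu>' * r0 powr (- \<alpha> - 2) < m"
  proof -
    have "\<epsilon> \<le> m / (2 * \<mu>' * r0 powr (- \<alpha> - 2))" by (simp add: \<epsilon>_def)
    then have "2 * (\<epsilon> * \<mu>' * r0 powr (- \<alpha> - 2)) \<le> m" using \<mu>' r0 by (simp add: field_simps)
    then show ?thesis using m by simp
  qed
  have \<epsilon>2: "\<epsilon> * (1/2) powr (- \<alpha>) < p (1/2)"
  proof -
    have "\<epsilon> \<le> p (1/2) / (2 * (1/2) powr (- \<alpha>))" by (simp add: \<epsilon>_def)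
    then have "2 * (\<epsilon> * (1/2) powr (- \<alpha>)) \<le> p (1/2)"
      by (simp add: pos_le_divide_eq mult_ac)
    then show ?thesis using p0(2)[of "1/2"] by simp
  qed
  define q where "q = (\<lambda>r. p r + k * (p r)\<^sup>2 - \<epsilon> * r powr (- \<alpha>))"
  define q1 where "q1 = (\<lambda>r. (1 + 2 * k * p r) * p1 r + \<epsilon> * \<alpha> * r powr (- \<alpha> - 1))"
  define q2 where "q2 = (\<lambda>r. (1 + 2 * k * p r) * p2 r + 2 * k * (p1 r)\<^sup>2
    - \<epsilon> * \<alpha> * (\<alpha> + 1) * r powr (- \<alpha> - 2))"
  have qd: "(q has_real_derivative q1 r) (at r)" if "0 < r" for r
    unfolding q_def q1_def
    by (rule derivative_eq_intros pd that | simp add: that algebra_simps)+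
  have q1d: "(q1 has_real_derivative q2 r) (at r)" if "0 < r" for r
  proof -
    have "((\<lambda>r. 1 + 2 * k * p r) has_real_derivative 0 + 2 * k * p1 r) (at r)"
      by (intro DERIV_add DERIV_const DERIV_cmult pd that)
    then have "(q1 has_real_derivative ((0 + 2 * k * p1 r) * p1 r + p2 r * (1 + 2 * k * p r))
        + \<epsilon> * \<alpha> * ((- \<alpha> - 1) * r powr (- \<alpha> - 1 - 1))) (at r)"
      unfolding q1_def
      by (rule DERIV_add[OF DERIV_mult[OF _ p1d[OF that]]
            DERIV_cmult[OF has_real_derivative_powr[OF that]]])
    moreover have "((0 + 2 * k * p1 r) * p1 r + p2 r * (1 + 2 * k * p r))
        + \<epsilon> * \<alpha> * ((- \<alpha> - 1) * r powr (- \<alpha> - 1 - 1)) = q2 r"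
      by (simp add: q2_def power2_eq_square algebra_simps)
    ultimately show ?thesis by simp
  qed
  have pc: "continuous_on {0<..} p" "continuous_on {0<..} p1"
    using pd p1d by (auto intro!: continuous_at_imp_continuous_on DERIV_isCont)
  have q2c: "continuous_on {0<..} q2"
    unfolding q2_def by (intro continuous_intros pc p2c) auto
  have sub: "0 < Phi (q2 r) (q1 r / r) + \<mu>' * r powr (- \<gamma>) * q r" if r: "0 < r" "r < 1" for r
  proof -
    define h where "h = 1 + 2 * k * p r"
    define \<rho> where "\<rho> = \<epsilon> * \<alpha> * r powr (- \<alpha> - 2)"
    have pr: "0 < p r" "p r \<le> 1" using p0(2,3)[of r] r by auto
    have h: "0 < h" using k pr by (simp add: h_def add_pos_pos)
    have \<rho>: "0 < \<rho>" using \<epsilon> \<alpha> r by (simp add: \<rho>_def)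
    define X where "X = h * p2 r"
    define Y where "Y = h * (p1 r / r)"
    \<comment> \<open>From (X, Y), a positive multiple of (p2, p1 / r), the arguments (q2, q1 / r)
      are reached in three moves, each controlled by one slope bound: first slot up, second slot up,
      first slot down.\<close>
    have "Phi X Y = h * (- (\<mu> * r powr (- \<gamma>) * p r))"
      unfolding X_def Y_def hom[OF h] using eq[OF r(1)] by simp
    moreover have "lam * (2 * k * (p1 r)\<^sup>2) \<le> Phi (X + 2 * k * (p1 r)\<^sup>2) Y - Phi X Y"
      using k by (intro fst_lower) simp
    moreover have "lam * n * \<rho> \<le>
        Phi (X + 2 * k * (p1 r)\<^sup>2) (Y + \<rho>) - Phi (X + 2 * k * (p1 r)\<^sup>2) Y"
      using \<rho> by (intro snd_lower) simp
    moreover have "Phi (X + 2 * k * (p1 r)\<^sup>2) (Y + \<rho>)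
        - Phi (X + 2 * k * (p1 r)\<^sup>2 - (\<alpha> + 1) * \<rho>) (Y + \<rho>) \<le> Lam * ((\<alpha> + 1) * \<rho>)"
      using fst_upper[of "(\<alpha> + 1) * \<rho>" "X + 2 * k * (p1 r)\<^sup>2 - (\<alpha> + 1) * \<rho>" "Y + \<rho>"] \<alpha> \<rho> by simp
    moreover have "q2 r = X + 2 * k * (p1 r)\<^sup>2 - (\<alpha> + 1) * \<rho>"
      by (simp add: q2_def X_def h_def \<rho>_def)
    moreover have "q1 r / r = Y + \<rho>"
    proof -
      have "r powr (- \<alpha> - 1) / r = r powr (- \<alpha> - 2)"
        using r by (simp add: powr_diff power2_eq_square)
      then show ?thesis 
        by (simp add: q1_def Y_def h_def \<rho>_def add_divide_distrib times_divide_eq_right[symmetric]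
            del: times_divide_eq_right)
    qed
    moreover have "lam * n * \<rho> - Lam * ((\<alpha> + 1) * \<rho>) = \<alpha> * Lam * \<rho>"
      using Lam_pos by (simp add: \<alpha>_def field_simps)
    ultimately have 1: "lam * (2 * k * (p1 r)\<^sup>2) + \<alpha> * Lam * \<rho> - h * (\<mu> * r powr (- \<gamma>) * p r)
        \<le> Phi (q2 r) (q1 r / r)" by simp
    have "h * \<mu> \<le> \<mu>' * (1 + k * p r)"
    proof -
      have "\<mu>' = \<mu> + 2 * k * \<mu>" using \<mu> by (simp add: k_def field_simps)
      then have "\<mu>' * (1 + k * p r) - h * \<mu> = 2 * k * \<mu> * (1 - p r) + 2 * k * \<mu> * (k * p r) + \<mu> * (k * p r)"
        by (simp add: h_def algebra_simps)
      moreover have "0 \<le> 2 * k * \<mu> * (1 - p r) + 2 * k * \<mu> * (k * p r) + \<mu> * (k * p r)"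
        using k \<mu> pr by (intro add_nonneg_nonneg mult_nonneg_nonneg) auto
      ultimately show ?thesis by simp
    qed
    then have 2: "h * \<mu> * (r powr (- \<gamma>) * p r) \<le> \<mu>' * (1 + k * p r) * (r powr (- \<gamma>) * p r)"
      using pr by (intro mult_right_mono) auto
    have "\<mu>' * r powr (- \<gamma>) * q r = \<mu>' * (1 + k * p r) * (r powr (- \<gamma>) * p r)
        - \<mu>' * \<epsilon> * (r powr (- \<gamma>) * r powr (- \<alpha>))"
      by (simp add: q_def algebra_simps power2_eq_square)
    also have "r powr (- \<gamma>) * r powr (- \<alpha>) = r powr b * r powr (- \<alpha> - 2)"
      by (simp add: powr_add[symmetric] b_def algebra_simps)
    finally have 3: "\<mu>' * r powr (- \<gamma>) * q r = \<mu>' * (1 + k * p r) * (r powr (- \<gamma>) * p r)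
        - \<epsilon> * r powr (- \<alpha> - 2) * (\<mu>' * r powr b)" by (simp add: mult_ac)
    have "0 < lam * (2 * k * (p1 r)\<^sup>2) + \<alpha> * Lam * \<rho> - \<epsilon> * r powr (- \<alpha> - 2) * (\<mu>' * r powr b)"
    proof (cases "r \<le> r0")
      case True
      have "\<epsilon> * r powr (- \<alpha> - 2) * (\<mu>' * r powr b) \<le> \<epsilon> * r powr (- \<alpha> - 2) * A"
        using r0b[OF r(1) True] \<epsilon> by (intro mult_left_mono) auto
      also have "\<dots> = \<alpha> * Lam * \<rho>" by (simp add: A_def \<rho>_def)
      finally have "\<epsilon> * r powr (- \<alpha> - 2) * (\<mu>' * r powr b) \<le> \<alpha> * Lam * \<rho>" .
      moreover have "0 < lam * (2 * k * (p1 r)\<^sup>2)" using neg[of r] r k lam_pos by simp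
      ultimately show ?thesis by linarith
    next
      case False
      have "r powr (- \<alpha> - 2) \<le> r0 powr (- \<alpha> - 2)"
        using False r0 \<alpha> by (intro powr_mono2') auto
      moreover have "r powr b \<le> 1" using r b powr_mono2[of b r 1] by simp
      ultimately have "\<epsilon> * r powr (- \<alpha> - 2) * (\<mu>' * r powr b) \<le> \<epsilon> * r0 powr (- \<alpha> - 2) * (\<mu>' * 1)"
        using \<epsilon> \<mu>' by (intro mult_mono mult_left_mono) auto
      moreover have "m \<le> lam * (2 * k * (p1 r)\<^sup>2)"
        using rm(2)[of r] False r k lam_pos by (simp add: m_def mult_left_mono)
      moreover have "0 < \<alpha> * Lam * \<rho>" using \<alpha> Lam_pos \<rho> by simp
      ultimately show ?thesis using \<epsilon>1 by (simp add: mult_ac)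
    qed
    then show ?thesis using 1 2 unfolding 3 by (simp add: mult_ac)
  qed
  \<comment> \<open>Since p + k p^2 \<le> 1 + k, it is enough that \<epsilon> \<delta> powr (-
    \<alpha>) be at least 1 + k.\<close>
  define \<delta> where "\<delta> = min (1/2) (((1 + k) / \<epsilon>) powr (- 1 / \<alpha>))"
  have \<delta>: "0 < \<delta>" "\<delta> \<le> 1/2" using k \<epsilon> by (auto simp: \<delta>_def)
  have "q \<delta> \<le> 0"
  proof -
    have "(((1 + k) / \<epsilon>) powr (- 1 / \<alpha>)) powr (- \<alpha>) \<le> \<delta> powr (- \<alpha>)"
      using \<alpha> \<delta> by (intro powr_mono2') (auto simp: \<delta>_def)
    then have "(1 + k) / \<epsilon> \<le> \<delta> powr (- \<alpha>)" using \<alpha> k \<epsilon> by (simp add: powr_powr)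
    then have "1 + k \<le> \<epsilon> * \<delta> powr (- \<alpha>)" using \<epsilon> by (simp add: field_simps)
    moreover have "0 < p \<delta>" "p \<delta> \<le> 1" using p0(2,3)[of \<delta>] \<delta> by auto
    moreover from this have "k * (p \<delta>)\<^sup>2 \<le> k * 1" using k by (intro mult_left_mono) (auto simp: power_le_one)
    ultimately show ?thesis by (simp add: q_def)
  qed
  have "q 1 < 0" using p0(1) \<epsilon> by (simp add: q_def)
  moreover have "isCont q 1" using qd[of 1] by (intro DERIV_isCont) auto
  ultimately have "\<forall>\<^sub>F r in at 1. q r < 0"
    by (auto simp: isCont_def intro: order_tendstoD)
  then obtain d where d: "0 < d" "\<And>r. r \<noteq> 1 \<Longrightarrow> dist r 1 < d \<Longrightarrow> q r < 0"
    by (auto simp: eventually_at)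
  \<comment> \<open>As q 1 = - \<epsilon> < 0, the outer radius can be taken strictly below
    1.\<close>
  define \<rho> where "\<rho> = max (1/2) (1 - d / 2)"
  have \<rho>: "1/2 \<le> \<rho>" "\<rho> < 1" "dist \<rho> 1 < d" using d(1) by (auto simp: \<rho>_def dist_real_def)
  have "0 \<le> k * (p (1/2))\<^sup>2" using k by simp
  then have "0 < q (1/2)" using \<epsilon>2 unfolding q_def by linarith
  from that[OF \<delta>(1,2) \<rho>(1,2) \<open>q \<delta> \<le> 0\<close> less_imp_le[OF d(2)] this qd q1d q2c sub] \<rho>
  show ?thesis by simp
qed

end

text \<open>On a ray through 0 the derivative of \<phi> vanishes at 0 and is bounded below by - K s,
  so \<phi> falls by at most K t^2; a fall of c t powr b with b < 2 is larger for small t.\<close>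

lemma no_C2_test_function_at_cusp:
  fixes \<phi> :: "real^'n \<Rightarrow> real"
  assumes C2: "has_C2_hessian_on W \<phi> g H" and W: "open W" "0 \<in> W"
    and b: "b < 2" and c: "0 < c"
    and le: "\<And>x. x \<in> W \<Longrightarrow> \<phi> x \<le> \<phi> 0 - c * norm x powr b"
  shows False
proof -
  define h :: "real^'n" where "h = axis undefined 1"
  have h: "norm h = 1" by (simp add: h_def)
  have g: "GDERIV \<phi> y :> g y" and H: "(g has_derivative (\<lambda>h. H y *v h)) (at y)"
    if "y \<in> W" for y
    using C2 that by (auto simp: has_C2_hessian_on_def)
  obtain e where e: "0 < e" "ball 0 e \<subseteq> W" using W open_contains_ball by blast
  have inW: "0 + t *\<^sub>R h \<in> W" if "\<bar>t\<bar> < e" for t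
    using e(2) that h by (auto simp: subset_iff)
  define f where "f = (\<lambda>t. \<phi> (0 + t *\<^sub>R h))"
  define f1 where "f1 = (\<lambda>t. h \<bullet> g (0 + t *\<^sub>R h))"
  have f: "(f has_real_derivative f1 t) (at t)" if "\<bar>t\<bar> < e" for t
    unfolding f_def f1_def using inW[OF that] by (intro real_derivative_line g)
  have fle: "f t \<le> f 0 - c * \<bar>t\<bar> powr b" if "\<bar>t\<bar> < e" for t
    using le[OF inW[OF that]] h by (simp add: f_def)
  have "\<forall>t. \<bar>0 - t\<bar> < e \<longrightarrow> f t \<le> f 0"
  proof (intro allI impI)
    fix t assume "\<bar>0 - t\<bar> < e"
    then have "f t \<le> f 0 - c * \<bar>t\<bar> powr b" by (intro fle) simp
    moreover have "0 \<le> c * \<bar>t\<bar> powr b" using c by simp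
    ultimately show "f t \<le> f 0" by linarith
  qed
  then have f10: "f1 0 = 0" using DERIV_local_max[OF f[of 0] e(1)] e(1) by simp
  define D where "D = h \<bullet> (H 0 *v h)"
  have "(f1 has_real_derivative D) (at 0)"
    unfolding f1_def D_def using H[OF W(2)] by (intro real_derivative_line_inner) simp
  then have "((\<lambda>t. f1 t / t) \<longlongrightarrow> D) (at 0)" using f10 by (simp add: DERIV_def)
  then have "\<forall>\<^sub>F t in at 0. D - 1 < f1 t / t" by (rule order_tendstoD) simp
  then obtain d where d: "0 < d" "\<And>t. t \<noteq> 0 \<Longrightarrow> dist t 0 < d \<Longrightarrow> D - 1 < f1 t / t"
    by (auto simp: eventually_at)
  define K where "K = \<bar>D\<bar> + 1"
  have K: "0 < K" "- K \<le> D - 1" by (auto simp: K_def)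
  \<comment> \<open>Below this threshold K t^2 < c t powr b; the minimum with d and e keeps the
    derivative estimates valid.\<close>
  define t where "t = min (min d e) ((c / K) powr (1 / (2 - b))) / 2"
  have t: "0 < t" "t < d" "t < e" "t < (c / K) powr (1 / (2 - b))"
    using d(1) e(1) c K by (auto simp: t_def min_def)
  have "t powr (2 - b) < ((c / K) powr (1 / (2 - b))) powr (2 - b)"
    using t b by (intro powr_less_mono2) auto
  then have "t powr (2 - b) < c / K" using b c K by (simp add: powr_powr)
  then have "K * t powr (2 - b) * t powr b < c * t powr b"
    using t K by (simp add: field_simps)
  moreover have "t powr (2 - b) * t powr b = t * t"
    using t by (simp add: powr_add[symmetric] power2_eq_square)
  ultimately have *: "K * (t * t) < c * t powr b" by (simp add: mult.assoc)
  have "(f has_real_derivative f1 s) (at s)" if "0 \<le> s" "s \<le> t" for s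
    using that t by (intro f) auto
  from MVT2[OF t(1) this] obtain s where s: "0 < s" "s < t" "f t - f 0 = (t - 0) * f1 s" by blast
  have "- K < f1 s / s" using d(2)[of s] s t K by (auto simp: dist_real_def)
  then have "- K * s \<le> f1 s" using s by (simp add: field_simps)
  moreover have "- K * t \<le> - K * s" using s K by simp
  ultimately have "t * (- K * t) \<le> t * f1 s" using t by (intro mult_left_mono) auto
  then have "- (K * (t * t)) \<le> f t - f 0" using s(3) by (simp add: mult_ac)
  then show False using fle[of t] * t by simp
qed

section \<open>Regularity and bounds for the eigenvalue\<close>

text \<open>Subadditivity of x powr b for b \<le> 1: after division by the larger number it reduces
  to w \<le> w powr b on [0, 1].\<close>

lemma abs_powr_diff_le:
  fixes b r t :: real
  assumes b: "0 < b" "b \<le> 1" and rt: "0 \<le> r" "0 \<le> t"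
  shows "\<bar>r powr b - t powr b\<bar> \<le> \<bar>r - t\<bar> powr b"
proof -
  have *: "z powr b - x powr b \<le> (z - x) powr b" if "0 \<le> x" "x \<le> z" for x z :: real
  proof (cases "z = 0")
    case False
    then have z: "0 < z" using that by simp
    have le: "w \<le> w powr b" if "0 \<le> w" "w \<le> 1" for w :: real
      using powr_mono'[of b 1 w] b that by (cases "w = 0") auto
    have "1 = x / z + (z - x) / z" using z by (simp add: field_simps)
    also have "\<dots> \<le> (x / z) powr b + ((z - x) / z) powr b"
      using that z by (intro add_mono le) auto
    also have "\<dots> = (x powr b + (z - x) powr b) / z powr b"
      using that z by (simp add: powr_divide add_divide_distrib)
    finally show ?thesis using z by (simp add: pos_le_divide_eq)
  qed (use that in auto)
  show ?thesis
  proof (cases "r \<le> t")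
    case True
    then show ?thesis using *[of r t] rt powr_mono2[of b r t] b by (simp add: abs_if)
  next
    case False
    then show ?thesis using *[of t r] rt powr_mono2[of b t r] b by (simp add: abs_if)
  qed
qed

lemma abs_powr_diff_le_lipschitz:
  fixes b r t :: real
  assumes b: "1 \<le> b" and rt: "0 \<le> r" "r \<le> 1" "0 \<le> t" "t \<le> 1"
  shows "\<bar>r powr b - t powr b\<bar> \<le> b * \<bar>r - t\<bar>"
proof -
  have *: "\<bar>z powr b - x powr b\<bar> \<le> b * \<bar>z - x\<bar>" if x: "0 \<le> x" "x < z" "z \<le> 1" for x z :: real
  proof -
    have "\<exists>l y. x < y \<and> y < z \<and> ((\<lambda>x. x powr b) has_real_derivative l) (at y) \<and>
        z powr b - x powr b = (z - x) * l"
    proof (rule MVT[OF x(2)])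
      show "continuous_on {x..z} (\<lambda>x. x powr b)"
        using x b by (intro continuous_on_powr' continuous_intros) auto
      show "(\<lambda>x. x powr b) differentiable at y" if "x < y" "y < z" for y
        using has_real_derivative_powr[of y b] that x by (auto simp: real_differentiable_def)
    qed
    then obtain l y where y: "x < y" "y < z" "((\<lambda>x. x powr b) has_real_derivative l) (at y)"
      "z powr b - x powr b = (z - x) * l" by blast
    have "l = b * y powr (b - 1)"
      using DERIV_unique[OF y(3) has_real_derivative_powr] y(1) x by simp
    moreover have "y powr (b - 1) \<le> 1" using powr_mono2[of "b - 1" y 1] y x b by simp
    moreover have "0 \<le> y powr (b - 1)" by simp
    ultimately have "\<bar>l\<bar> \<le> b" using b by (simp add: abs_mult mult_left_le)
    then show ?thesis
      unfolding y(4) using x by (simp add: abs_mult mult.commute mult_right_mono)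
  qed
  show ?thesis using *[of r t] *[of t r] rt
    by (cases r t rule: linorder_cases) (auto simp: abs_minus_commute)
qed

lemma radial_lipschitz:
  fixes p :: "real \<Rightarrow> real"
  assumes C: "0 \<le> C" and b: "1 \<le> b"
    and p: "\<And>r t. 0 \<le> r \<Longrightarrow> r \<le> 1 \<Longrightarrow> 0 \<le> t \<Longrightarrow> t \<le> 1 \<Longrightarrow> \<bar>p r - p t\<bar> \<le> C * \<bar>r powr b - t powr b\<bar>"
  shows "(C * b)-lipschitz_on (ball 0 1) (\<lambda>x::real^'n. p (norm x))"
proof (rule lipschitz_onI)
  fix x y :: "real^'n" assume "x \<in> ball 0 1" "y \<in> ball 0 1"
  then have xy: "norm x \<le> 1" "norm y \<le> 1" by auto
  have "\<bar>p (norm x) - p (norm y)\<bar> \<le> C * \<bar>norm x powr b - norm y powr b\<bar>"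
    using xy by (intro p) auto
  also have "\<dots> \<le> C * (b * \<bar>norm x - norm y\<bar>)"
    using xy C b by (intro mult_left_mono abs_powr_diff_le_lipschitz) auto
  also have "\<dots> \<le> C * (b * norm (x - y))"
    using C b norm_triangle_ineq3[of x y] by (intro mult_left_mono) auto
  finally show "dist (p (norm x)) (p (norm y)) \<le> C * b * dist x y"
    by (simp add: dist_norm mult.assoc)
qed (use C b in auto)

lemma radial_holder:
  fixes p :: "real \<Rightarrow> real"
  assumes C: "0 \<le> C" and b: "0 < b" "b \<le> 1"
    and p: "\<And>r t. 0 \<le> r \<Longrightarrow> r \<le> 1 \<Longrightarrow> 0 \<le> t \<Longrightarrow> t \<le> 1 \<Longrightarrow> \<bar>p r - p t\<bar> \<le> C * \<bar>r powr b - t powr b\<bar>"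
  shows "holder_on b (ball 0 1) (\<lambda>x::real^'n. p (norm x))"
  unfolding holder_on_def
proof (intro exI[of _ C] ballI)
  fix x y :: "real^'n" assume "x \<in> ball 0 1" "y \<in> ball 0 1"
  then have xy: "norm x \<le> 1" "norm y \<le> 1" by auto
  have "\<bar>p (norm x) - p (norm y)\<bar> \<le> C * \<bar>norm x powr b - norm y powr b\<bar>"
    using xy by (intro p) auto
  also have "\<dots> \<le> C * \<bar>norm x - norm y\<bar> powr b"
    using C b by (intro mult_left_mono abs_powr_diff_le) auto
  also have "\<dots> \<le> C * norm (x - y) powr b"
    using C b norm_triangle_ineq3[of x y] by (intro mult_left_mono powr_mono2) auto
  finally show "\<bar>p (norm x) - p (norm y)\<bar> \<le> C * dist x y powr b" by (simp add: dist_norm)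
qed

lemma radial_C1:
  fixes p :: "real \<Rightarrow> real"
  assumes C: "0 \<le> C" and b: "1 < b"
    and C2: "has_C2_hessian_on {x::real^'n. 0 < norm x} (\<lambda>x. p (norm x))
      (\<lambda>x. (p1 (norm x) / norm x) *\<^sub>R x) H"
    and p: "\<And>r t. 0 \<le> r \<Longrightarrow> r \<le> 1 \<Longrightarrow> 0 \<le> t \<Longrightarrow> t \<le> 1 \<Longrightarrow> \<bar>p r - p t\<bar> \<le> C * \<bar>r powr b - t powr b\<bar>"
    and p1: "\<And>r. 0 < r \<Longrightarrow> r \<le> 1 \<Longrightarrow> \<bar>p1 r\<bar> \<le> C * r powr (b - 1)"
  shows "C1_on (ball 0 1) (\<lambda>x::real^'n. p (norm x))"
proof -
  \<comment> \<open>At x = 0 the factor x makes this 0, which is the gradient there because |p(r) -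
    p(0)| / r is of order r powr (b - 1).\<close>
  define g where "g = (\<lambda>x::real^'n. (p1 (norm x) / norm x) *\<^sub>R x)"
  have "((\<lambda>x::real^'n. C * norm x powr (b - 1)) \<longlongrightarrow> C * norm (0::real^'n) powr (b - 1)) (at 0)"
    using b by (intro tendsto_mult tendsto_const tendsto_powr' tendsto_norm tendsto_ident_at) auto
  then have lim: "((\<lambda>x::real^'n. C * norm x powr (b - 1)) \<longlongrightarrow> 0) (at 0)" by simp
  have d0: "((\<lambda>x::real^'n. p (norm x)) has_derivative (\<lambda>h. h \<bullet> g 0)) (at 0)"
  proof (rule has_derivativeI_sandwich[of 1])
    fix y :: "real^'n" assume y: "y \<noteq> 0" "dist y 0 < 1"
    have "\<bar>p (norm y) - p 0\<bar> \<le> C * \<bar>norm y powr b - 0 powr b\<bar>"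
      using y by (intro p) auto
    then have "\<bar>p (norm y) - p 0\<bar> / norm y \<le> C * norm y powr b / norm y"
      by (intro divide_right_mono) auto
    also have "\<dots> = C * norm y powr (b - 1)" using y by (simp add: powr_diff)
    finally show "norm (p (norm y) - p (norm (0::real^'n)) - (y - 0) \<bullet> g 0) / norm (y - 0)
        \<le> C * norm y powr (b - 1)" by (simp add: g_def)
  qed (use lim in \<open>auto intro: bounded_linear_inner_left\<close>)
  have "GDERIV (\<lambda>x. p (norm x)) x :> g x" for x :: "real^'n"
    using C2 d0 by (cases "x = 0") (auto simp: has_C2_hessian_on_def g_def gderiv_def)
  moreover have "isCont g x" for x
  proof (cases "x = 0")
    case False
    then have "(g has_derivative (\<lambda>h. H x *v h)) (at x)"
      using C2 by (simp add: has_C2_hessian_on_def g_def)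
    then show ?thesis by (rule has_derivative_continuous)
  next
    case True
    have "(g \<longlongrightarrow> 0) (at 0)"
    proof (rule Lim_null_comparison[OF _ lim])
      have "norm (g x) \<le> C * norm x powr (b - 1)" if "x \<noteq> 0" "dist x 0 < 1" for x
        using p1[of "norm x"] that by (simp add: g_def)
      then show "\<forall>\<^sub>F x in at 0. norm (g x) \<le> C * norm x powr (b - 1)"
        by (auto simp: eventually_at intro!: exI[of _ 1])
    qed
    then show ?thesis using True by (simp add: isCont_def g_def)
  qed
  then have "continuous_on (ball 0 1) g" by (intro continuous_at_imp_continuous_on) auto
  ultimately show ?thesis unfolding C1_on_def by blast
qed

text \<open>\<open>m\<close> is the weight for which the barrier is a strict subsolution. Any
  potential with \<nu> f \<ge> m on the annulus, on any domain containing it, inherits the bound, so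
  one barrier serves all the approximating problems.\<close>

lemma principal_eigenvalue_le_radial:
  fixes F :: "real^'n^'n \<Rightarrow> real" and f :: "real^'n \<Rightarrow> real"
  assumes hom: "positively_homogeneous F" and rot: "rotationally_invariant F"
    and \<delta>: "0 < \<delta>" "\<delta> \<le> r1" "r1 \<le> \<rho>" and bdry: "q \<delta> \<le> 0" "q \<rho> \<le> 0" and r1: "0 < q r1"
    and q: "\<And>r. 0 < r \<Longrightarrow> (q has_real_derivative q1 r) (at r)"
    and q1: "\<And>r. 0 < r \<Longrightarrow> (q1 has_real_derivative q2 r) (at r)"
    and q2: "continuous_on {0<..} q2"
    and sub: "\<And>r. \<delta> < r \<Longrightarrow> r < \<rho> \<Longrightarrow> 0 < radial_profile F (q2 r) (q1 r / r) + m r * q r"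
    and \<Omega>: "{x. \<delta> \<le> norm x \<and> norm x \<le> \<rho>} \<subseteq> \<Omega>"
    and f: "\<And>x. \<delta> < norm x \<Longrightarrow> norm x < \<rho> \<Longrightarrow> 0 \<le> f x"
      "\<And>x. \<delta> < norm x \<Longrightarrow> norm x < \<rho> \<Longrightarrow> m (norm x) \<le> \<nu> * f x"
  shows "principal_eigenvalue F f \<Omega> \<le> ereal \<nu>"
proof (rule principal_eigenvalue_le[OF hom])
  define W where "W = {x::real^'n. norm x \<in> {\<delta><..<\<rho>}}"
  define K where "K = {x::real^'n. norm x \<in> {\<delta>..\<rho>}}"
  define h where "h = (\<lambda>x::real^'n. radial_matrix (q2 (norm x)) (q1 (norm x) / norm x) (x /\<^sub>R norm x))"
  show "open W"
  proof -
    have "W = norm -` {\<delta><..<\<rho>}" by (auto simp: W_def)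
    then show ?thesis by (auto intro!: open_vimage continuous_intros)
  qed
  show "W \<subseteq> K" by (auto simp: W_def K_def)
  show "K \<subseteq> \<Omega>" using \<Omega> by (auto simp: K_def)
  have "K = cball 0 \<rho> \<inter> {x. \<delta> \<le> norm x}" by (auto simp: K_def)
  moreover have "closed {x::real^'n. \<delta> \<le> norm x}" by (intro closed_Collect_le continuous_intros)
  ultimately show "compact K" by (simp add: compact_Int_closed)
  show "has_C2_hessian_on W (\<lambda>x. q (norm x)) (\<lambda>x. (q1 (norm x) / norm x) *\<^sub>R x) h"
    unfolding W_def h_def using \<delta>(1)
    by (intro radial_has_C2_hessian q q1 continuous_on_subset[OF q2]) auto
  have "continuous_on {0<..} q"
    using q by (auto intro!: continuous_at_imp_continuous_on DERIV_isCont)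
  then show "continuous_on K (\<lambda>x. q (norm x))"
    by (rule continuous_on_compose2) (use \<delta>(1) in \<open>auto simp: K_def intro!: continuous_intros\<close>)
  show "q (norm x) \<le> 0" if "x \<in> K - W" for x
  proof -
    have "norm x = \<delta> \<or> norm x = \<rho>" using that by (auto simp: K_def W_def)
    then show ?thesis using bdry by auto
  qed
  show "r1 *\<^sub>R axis undefined 1 \<in> K" "0 < q (norm (r1 *\<^sub>R axis undefined 1 :: real^'n))"
    using \<delta> r1 by (auto simp: K_def)
  show "0 \<le> f x" if "x \<in> W" for x using that f by (auto simp: W_def)
  show "0 < F (h x) + \<nu> * f x * q (norm x)" if x: "x \<in> W" "0 < q (norm x)" for x
  proof -
    have r: "\<delta> < norm x" "norm x < \<rho>" using x by (auto simp: W_def)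
    moreover from this have "norm x \<noteq> 0" using \<delta>(1) by linarith
    ultimately have "norm (x /\<^sub>R norm x) = 1" by simp
    then have "F (h x) = radial_profile F (q2 (norm x)) (q1 (norm x) / norm x)"
      unfolding h_def by (rule radial_profile_eq[OF rot])
    moreover have "m (norm x) * q (norm x) \<le> \<nu> * f x * q (norm x)"
      using f(2)[OF r] x(2) by (intro mult_right_mono) auto
    ultimately show ?thesis using sub[OF r] by linarith
  qed
qed

text \<open>The condition at the origin is vacuous, so it suffices to compare the potentials away
  from it; elsewhere the origin is deleted from the neighbourhood of the test function.\<close>

lemma viscosity_supersolution_across_cusp:
  fixes F :: "real^'n^'n \<Rightarrow> real"
  assumes visc: "viscosity_supersolution F (\<lambda>x. \<mu> * f x) (ball 0 1 - {0}) u"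
    and u: "\<And>x. x \<in> ball 0 1 \<Longrightarrow> 0 < u x" and \<mu>: "0 \<le> \<mu>"
    and cusp: "\<And>x. x \<in> ball 0 1 \<Longrightarrow> u x \<le> u 0 - c * norm x powr b" and b: "b < 2" "0 < c"
    and f: "\<And>x. x \<noteq> 0 \<Longrightarrow> f' x \<le> f x"
  shows "viscosity_supersolution F (\<lambda>x. \<mu> * f' x) (ball 0 1) u"
  unfolding viscosity_supersolution_def
proof (intro allI impI)
  fix x0 W \<phi> g H
  assume W: "open W" "x0 \<in> W" "W \<subseteq> ball 0 1" "has_C2_hessian_on W \<phi> g H"
    and min: "\<forall>x\<in>W. u x0 - \<phi> x0 \<le> u x - \<phi> x"
  show "F (H x0) + \<mu> * f' x0 * u x0 \<le> 0"
  proof (cases "x0 = 0")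
    case True
    have "\<phi> x \<le> \<phi> 0 - c * norm x powr b" if "x \<in> W" for x
    proof -
      have "u x \<le> u 0 - c * norm x powr b" using that W(3) by (intro cusp) auto
      moreover have "u 0 - \<phi> 0 \<le> u x - \<phi> x" using min that True by auto
      ultimately show ?thesis by linarith
    qed
    then show ?thesis
      using no_C2_test_function_at_cusp[OF W(4,1) _ b] W(2) True by blast
  next
    case False
    have "has_C2_hessian_on (W - {0}) \<phi> g H" by (rule has_C2_hessian_on_subset[OF W(4)]) auto
    moreover have "open (W - {0})" using W(1) by (rule open_delete)
    moreover have "x0 \<in> W - {0}" "W - {0} \<subseteq> ball 0 1 - {0}" using False W by auto
    ultimately have "F (H x0) + \<mu> * f x0 * u x0 \<le> 0"
      using visc min unfolding viscosity_supersolution_def by blast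
    moreover have "\<mu> * f' x0 * u x0 \<le> \<mu> * f x0 * u x0"
      using f[OF False] \<mu> u[of x0] W by (intro mult_right_mono mult_left_mono) auto
    ultimately show ?thesis by linarith
  qed
qed

section \<open>Existence, regularity and stability assembled from the radial profile and the
  barrier\<close>

theorem theorem1p1:
  fixes F :: "real^'n^'n \<Rightarrow> real" and lam Lam \<gamma> :: real
  assumes "0 < lam" and "lam \<le> Lam"
    and "lam / Lam * (real CARD('n) - 1) + 1 > 2"
    and "continuous_on sym_matrices F"
    and "uniformly_elliptic lam Lam F"
    and "rotationally_invariant F"
    and "positively_homogeneous F"
    and "0 < \<gamma>" and "\<gamma> < 2"
  shows
    "(\<exists>\<mu>::real. singular_eigenvalue F \<gamma> = ereal \<mu> \<and> 0 < \<mu> \<and>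
       (\<exists>u :: real^'n \<Rightarrow> real.
          (\<exists>v :: real \<Rightarrow> real. \<forall>x\<in>cball 0 1. u x = v (norm x)) \<and>
          continuous_on (cball 0 1) u \<and>
          (\<forall>x\<in>ball 0 1. 0 < u x) \<and>
          viscosity_solution F (\<lambda>x. \<mu> * norm x powr (- \<gamma>)) (ball 0 1 - {0}) u \<and>
          (\<forall>x\<in>sphere 0 1. u x = 0) \<and>
          C2_on (ball 0 1 - {0}) u \<and>
          (\<gamma> \<le> 1 \<longrightarrow> (\<exists>L. L-lipschitz_on (ball 0 1) u)) \<and>
          (\<gamma> < 1 \<longrightarrow> C1_on (ball 0 1) u) \<and>
          (\<gamma> > 1 \<longrightarrow> holder_on (2 - \<gamma>) (ball 0 1) u))) \<and>
     ((\<lambda>\<epsilon>. principal_eigenvalue F (\<lambda>x. 1 / ((norm x)\<^sup>2 + \<epsilon>\<^sup>2) powr (\<gamma> / 2)) (ball 0 1))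
        \<longlongrightarrow> singular_eigenvalue F \<gamma>) (at 0) \<and>
     ((\<lambda>\<delta>. principal_eigenvalue F (\<lambda>x. norm x powr (- \<gamma>)) (ball 0 1 - cball 0 \<delta>))
        \<longlongrightarrow> singular_eigenvalue F \<gamma>) (at_right 0)"
proof -
  note ell = assms(5) and rot = assms(6) and hom = assms(7) and \<gamma> = assms(8,9)
  interpret op: radial_operator "radial_profile F" lam Lam "real CARD('n) - 1"
    by (rule radial_operator_profile) (use assms in auto)
  show ?thesis
  proof (rule op.radial_eigenprofile[OF \<gamma>])
    fix \<mu> C c p p1 p2
    assume \<mu>: "0 < \<mu>" and C: "0 < C" and c: "0 < c"
      and pc: "continuous_on {0..} p" and p0: "p 0 = 1" and p_1: "p 1 = 0"
      and ppos: "\<And>r. 0 \<le> r \<Longrightarrow> r < 1 \<Longrightarrow> 0 < p r"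
      and pd: "\<And>r. 0 < r \<Longrightarrow> (p has_real_derivative p1 r) (at r)"
      and p1d: "\<And>r. 0 < r \<Longrightarrow> (p1 has_real_derivative p2 r) (at r)"
      and p2c: "continuous_on {0<..} p2"
      and eq: "\<And>r. 0 < r \<Longrightarrow> radial_profile F (p2 r) (p1 r / r) = - (\<mu> * r powr (- \<gamma>) * p r)"
      and neg: "\<And>r. 0 < r \<Longrightarrow> r \<le> 1 \<Longrightarrow> p1 r < 0"
      and lip: "\<And>r t. 0 \<le> r \<Longrightarrow> r \<le> 1 \<Longrightarrow> 0 \<le> t \<Longrightarrow> t \<le> 1 \<Longrightarrow>
        \<bar>p r - p t\<bar> \<le> C * \<bar>r powr (2 - \<gamma>) - t powr (2 - \<gamma>)\<bar>"
      and cusp: "\<And>r. 0 \<le> r \<Longrightarrow> r \<le> 1 \<Longrightarrow> p r \<le> 1 - c * r powr (2 - \<gamma>)"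
      and p1b: "\<And>r. 0 < r \<Longrightarrow> r \<le> 1 \<Longrightarrow> \<bar>p1 r\<bar> \<le> C * r powr (1 - \<gamma>)"
    define u where "u = (\<lambda>x::real^'n. p (norm x))"
    define f where "f = (\<lambda>x::real^'n. norm x powr (- \<gamma>))"
    define f' where "f' = (\<lambda>\<epsilon> x::real^'n. 1 / ((norm x)\<^sup>2 + \<epsilon>\<^sup>2) powr (\<gamma> / 2))"
    define g where "g = (\<lambda>x::real^'n. (p1 (norm x) / norm x) *\<^sub>R x)"
    define H where "H = (\<lambda>x::real^'n.
      radial_matrix (p2 (norm x)) (p1 (norm x) / norm x) (x /\<^sub>R norm x))"
    have C2: "has_C2_hessian_on {x. 0 < norm x} u g H"
      unfolding u_def g_def H_def
      using radial_has_C2_hessian[of "{0<..}" p p1 p2] pd p1d p2c by simp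
    have C2': "has_C2_hessian_on (ball 0 1 - {0}) u g H"
      by (rule has_C2_hessian_on_subset[OF C2]) auto
    have equ: "F (H x) + \<mu> * f x * u x = 0" if "x \<in> ball 0 1 - {0}" for x
    proof -
      have x: "0 < norm x" "norm (x /\<^sub>R norm x) = 1" using that by auto
      show ?thesis
        unfolding H_def radial_profile_eq[OF rot x(2)] eq[OF x(1)] by (simp add: u_def f_def)
    qed
    have uc: "continuous_on (cball 0 1) u"
      unfolding u_def by (rule continuous_on_compose2[OF pc]) (auto intro!: continuous_intros)
    have upos: "0 < u x" if "x \<in> ball 0 1" for x using that ppos by (simp add: u_def)
    have op: "open (ball 0 1 - {0::real^'n})" by (intro open_delete open_ball)
    have sup: "viscosity_supersolution F (\<lambda>x. \<mu> * f x) (ball 0 1 - {0}) u"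
      by (rule classical_imp_viscosity_supersolution[OF ell _ op C2']) (use equ assms(1) in auto)
    have sub: "viscosity_subsolution F (\<lambda>x. \<mu> * f x) (ball 0 1 - {0}) u"
      by (rule classical_imp_viscosity_subsolution[OF ell _ op C2']) (use equ assms(1) in auto)
    have ple1: "p r \<le> 1" if "0 \<le> r" "r \<le> 1" for r
    proof -
      have "0 \<le> c * r powr (2 - \<gamma>)" using c by simp
      then show ?thesis using cusp[OF that] by linarith
    qed
    \<comment> \<open>The annulus depends on \<mu>' alone and is fixed before domain, potential and
      bound; this uniformity is what both limits use.\<close>
    have upper: "\<exists>\<delta> \<rho>. 0 < \<delta> \<and> \<rho> < 1 \<and> (\<forall>\<Omega> h \<nu>. {x. \<delta> \<le> norm x \<and> norm x \<le> \<rho>} \<subseteq> \<Omega> \<longrightarrow>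
        (\<forall>x. \<delta> < norm x \<longrightarrow> norm x < \<rho> \<longrightarrow> 0 \<le> h x \<and> \<mu>' * f x \<le> \<nu> * h x) \<longrightarrow>
        principal_eigenvalue F h \<Omega> \<le> ereal \<nu>)" if \<mu>': "\<mu> < \<mu>'" for \<mu>'
    proof (rule op.radial_barrier[OF \<gamma> \<mu> \<mu>' p_1 ppos ple1 pd p1d p2c eq neg])
      fix \<delta> \<rho> r q q1 q2
      assume *: "0 < \<delta>" "\<delta> \<le> r" "r \<le> \<rho>" "\<rho> < 1" "q \<delta> \<le> 0" "q \<rho> \<le> 0" "0 < q r"
        "\<And>r. 0 < r \<Longrightarrow> (q has_real_derivative q1 r) (at r)"
        "\<And>r. 0 < r \<Longrightarrow> (q1 has_real_derivative q2 r) (at r)"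
        "continuous_on {0<..} q2"
        "\<And>r. 0 < r \<Longrightarrow> r < 1 \<Longrightarrow>
          0 < radial_profile F (q2 r) (q1 r / r) + \<mu>' * r powr (- \<gamma>) * q r"
      have "principal_eigenvalue F h \<Omega> \<le> ereal \<nu>"
        if "{x. \<delta> \<le> norm x \<and> norm x \<le> \<rho>} \<subseteq> \<Omega>"
          "\<forall>x. \<delta> < norm x \<longrightarrow> norm x < \<rho> \<longrightarrow> 0 \<le> h x \<and> \<mu>' * f x \<le> \<nu> * h x" for \<Omega> h \<nu>
        by (rule principal_eigenvalue_le_radial[OF hom rot *(1-3,5-10),
              where m="\<lambda>r. \<mu>' * r powr (- \<gamma>)"])
          (use * that in \<open>auto simp: f_def\<close>)
      then show ?thesis using *(1,4) by blast
    qed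
    have ge: "ereal \<mu> \<le> principal_eigenvalue F f (ball 0 1 - {0})"
      by (rule principal_eigenvalue_ge[OF _ _ sup])
        (use upos in \<open>auto intro: continuous_on_subset[OF uc]\<close>)
    have le: "principal_eigenvalue F f (ball 0 1 - {0}) \<le> ereal \<mu>"
    proof (rule ereal_le_epsilon2)
      fix e :: real assume "0 < e"
      then obtain \<delta> \<rho> where *: "0 < \<delta>" "\<rho> < 1" "\<And>\<Omega> h \<nu>. {x. \<delta> \<le> norm x \<and> norm x \<le> \<rho>} \<subseteq> \<Omega> \<Longrightarrow>
        (\<forall>x. \<delta> < norm x \<longrightarrow> norm x < \<rho> \<longrightarrow> 0 \<le> h x \<and> (\<mu> + e) * f x \<le> \<nu> * h x) \<Longrightarrow>
        principal_eigenvalue F h \<Omega> \<le> ereal \<nu>"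
        using upper[of "\<mu> + e"] by auto
      have "principal_eigenvalue F f (ball 0 1 - {0}) \<le> ereal (\<mu> + e)"
        by (rule *(3)) (use *(1,2) in \<open>auto simp: f_def\<close>)
      then show "principal_eigenvalue F f (ball 0 1 - {0}) \<le> ereal \<mu> + ereal e" by simp
    qed
    have sing: "singular_eigenvalue F \<gamma> = ereal \<mu>"
      using le ge unfolding singular_eigenvalue_def f_def by (rule antisym)
    have sq: "((norm x)\<^sup>2) powr (\<gamma> / 2) = norm x powr \<gamma>" for x :: "real^'n"
      using powr_powr[of "norm x" 2 "\<gamma> / 2"] by simp
    have f_eq: "f x = 1 / norm x powr \<gamma>" for x
      by (simp only: f_def powr_minus_divide)
    have f'_le: "f' \<epsilon> x \<le> f x" if "x \<noteq> 0" for \<epsilon> x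
    proof -
      have "norm x powr \<gamma> \<le> ((norm x)\<^sup>2 + \<epsilon>\<^sup>2) powr (\<gamma> / 2)"
      proof -
        have "((norm x)\<^sup>2) powr (\<gamma> / 2) \<le> ((norm x)\<^sup>2 + \<epsilon>\<^sup>2) powr (\<gamma> / 2)"
          using \<gamma> by (intro powr_mono2) auto
        then show ?thesis by (simp only: sq)
      qed
      then have "1 / ((norm x)\<^sup>2 + \<epsilon>\<^sup>2) powr (\<gamma> / 2) \<le> 1 / norm x powr \<gamma>"
        using that by (intro frac_le) (simp_all only: zero_le_one order_refl powr_gt_zero norm_eq_zero simp_thms)
      then show ?thesis by (simp only: f_eq f'_def)
    qed
    \<comment> \<open>Away from the origin the two potentials differ by a factor that tends to 1
      uniformly as \<epsilon> tends to 0.\<close>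
    have f'_ge: "f x \<le> (1 + \<epsilon>\<^sup>2 / \<delta>\<^sup>2) powr (\<gamma> / 2) * f' \<epsilon> x" if "0 < \<delta>" "\<delta> < norm x" for \<delta> \<epsilon> x
    proof -
      define P where "P = (1 + \<epsilon>\<^sup>2 / \<delta>\<^sup>2) powr (\<gamma> / 2)"
      define Q where "Q = ((norm x)\<^sup>2 + \<epsilon>\<^sup>2) powr (\<gamma> / 2)"
      have r: "0 < norm x" using that by linarith
      have "0 < 1 + \<epsilon>\<^sup>2 / \<delta>\<^sup>2" by (intro add_pos_nonneg) auto
      have "0 < (norm x)\<^sup>2 + \<epsilon>\<^sup>2" using r by (intro add_pos_nonneg) auto
      then have Q: "0 < Q" unfolding Q_def powr_gt_zero by linarith
      have "\<epsilon>\<^sup>2 * \<delta>\<^sup>2 \<le> \<epsilon>\<^sup>2 * (norm x)\<^sup>2" using that by (intro mult_left_mono power_mono) auto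
      then have "(norm x)\<^sup>2 + \<epsilon>\<^sup>2 \<le> (norm x)\<^sup>2 * (1 + \<epsilon>\<^sup>2 / \<delta>\<^sup>2)"
        using that(1) by (simp add: field_simps)
      then have "Q \<le> ((norm x)\<^sup>2 * (1 + \<epsilon>\<^sup>2 / \<delta>\<^sup>2)) powr (\<gamma> / 2)"
        unfolding Q_def using \<gamma> by (intro powr_mono2) auto
      also have "\<dots> = ((norm x)\<^sup>2) powr (\<gamma> / 2) * P"
        unfolding P_def by (rule powr_mult)
      finally have "Q \<le> norm x powr \<gamma> * P" unfolding sq .
      then have "1 / norm x powr \<gamma> \<le> P / Q" using Q r by (simp add: field_simps)
      then show ?thesis by (simp only: f_eq f'_def P_def Q_def times_divide_eq_right mult_1_right)
    qed
    have ball_ge: "ereal \<mu> \<le> principal_eigenvalue F (f' \<epsilon>) (ball 0 1)" for \<epsilon>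
    proof (rule principal_eigenvalue_ge)
      show "viscosity_supersolution F (\<lambda>x. \<mu> * f' \<epsilon> x) (ball 0 1) u"
      proof (rule viscosity_supersolution_across_cusp[OF sup upos])
        show "u x \<le> u 0 - c * norm x powr (2 - \<gamma>)" if "x \<in> ball 0 1" for x
          using cusp[of "norm x"] that p0 by (simp add: u_def)
      qed (use \<mu> \<gamma> c f'_le in auto)
    qed (use upos in \<open>auto intro: continuous_on_subset[OF uc]\<close>)
    have lim1: "((\<lambda>\<epsilon>. principal_eigenvalue F (f' \<epsilon>) (ball 0 1)) \<longlongrightarrow> ereal \<mu>) (at 0)"
    proof (rule order_tendstoI)
      fix a assume "a < ereal \<mu>"
      then show "\<forall>\<^sub>F \<epsilon> in at 0. a < principal_eigenvalue F (f' \<epsilon>) (ball 0 1)"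
        using ball_ge by (intro always_eventually allI) (rule less_le_trans)
    next
      fix a assume "ereal \<mu> < a"
      then obtain \<nu> where \<nu>: "\<mu> < \<nu>" "ereal \<nu> < a" using ereal_dense2 by force
      \<comment> \<open>Strictly between \<mu> and \<nu>, leaving room for the factor that tends to
        1.\<close>
      define \<mu>' where "\<mu>' = (\<mu> + \<nu>) / 2"
      have \<mu>': "\<mu> < \<mu>'" "\<mu>' < \<nu>" using \<nu> by (auto simp: \<mu>'_def)
      obtain \<delta> \<rho> where *: "0 < \<delta>" "\<rho> < 1" "\<And>\<Omega> h \<nu>. {x. \<delta> \<le> norm x \<and> norm x \<le> \<rho>} \<subseteq> \<Omega> \<Longrightarrow>
        (\<forall>x. \<delta> < norm x \<longrightarrow> norm x < \<rho> \<longrightarrow> 0 \<le> h x \<and> \<mu>' * f x \<le> \<nu> * h x) \<Longrightarrow>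
        principal_eigenvalue F h \<Omega> \<le> ereal \<nu>"
        using upper[OF \<mu>'(1)] by auto
      have "((\<lambda>\<epsilon>. \<mu>' * (1 + \<epsilon>\<^sup>2 / \<delta>\<^sup>2) powr (\<gamma> / 2)) \<longlongrightarrow> \<mu>' * (1 + 0\<^sup>2 / \<delta>\<^sup>2) powr (\<gamma> / 2)) (at 0)"
        using *(1) by (intro tendsto_intros) auto
      then have "\<forall>\<^sub>F \<epsilon> in at 0. \<mu>' * (1 + \<epsilon>\<^sup>2 / \<delta>\<^sup>2) powr (\<gamma> / 2) < \<nu>"
        by (rule order_tendstoD) (use \<mu>' in simp)
      then show "\<forall>\<^sub>F \<epsilon> in at 0. principal_eigenvalue F (f' \<epsilon>) (ball 0 1) < a"
      proof eventually_elim
        fix \<epsilon> assume \<epsilon>: "\<mu>' * (1 + \<epsilon>\<^sup>2 / \<delta>\<^sup>2) powr (\<gamma> / 2) < \<nu>"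
        have "0 \<le> f' \<epsilon> x \<and> \<mu>' * f x \<le> \<nu> * f' \<epsilon> x" if "\<delta> < norm x" for x
        proof
          show "0 \<le> f' \<epsilon> x" by (simp add: f'_def)
          then have "\<mu>' * (1 + \<epsilon>\<^sup>2 / \<delta>\<^sup>2) powr (\<gamma> / 2) * f' \<epsilon> x \<le> \<nu> * f' \<epsilon> x"
            using \<epsilon> by (intro mult_right_mono) auto
          moreover have "\<mu>' * f x \<le> \<mu>' * ((1 + \<epsilon>\<^sup>2 / \<delta>\<^sup>2) powr (\<gamma> / 2) * f' \<epsilon> x)"
            using f'_ge[OF *(1) that] \<mu> \<mu>' by (intro mult_left_mono) auto
          ultimately show "\<mu>' * f x \<le> \<nu> * f' \<epsilon> x" by (simp add: mult.assoc)
        qed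
        then have "principal_eigenvalue F (f' \<epsilon>) (ball 0 1) \<le> ereal \<nu>"
          using *(2) by (intro *(3)) auto
        then show "principal_eigenvalue F (f' \<epsilon>) (ball 0 1) < a" using \<nu>(2) by (rule le_less_trans)
      qed
    qed
    have lim2: "((\<lambda>\<delta>. principal_eigenvalue F f (ball 0 1 - cball 0 \<delta>)) \<longlongrightarrow> ereal \<mu>) (at_right 0)"
    proof (rule order_tendstoI)
      \<comment> \<open>The lower bound is monotonicity in the domain: removing a closed ball
        instead of a point can only raise the eigenvalue.\<close>
      fix a assume a: "a < ereal \<mu>"
      have "\<forall>\<^sub>F \<delta> in at_right (0::real). \<delta> \<in> {0<..<1}" by (rule eventually_at_right_real) simp
      then show "\<forall>\<^sub>F \<delta> in at_right 0. a < principal_eigenvalue F f (ball 0 1 - cball 0 \<delta>)"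
      proof eventually_elim
        fix \<delta> :: real assume "\<delta> \<in> {0<..<1}"
        then have "principal_eigenvalue F f (ball 0 1 - {0})
            \<le> principal_eigenvalue F f (ball 0 1 - cball 0 \<delta>)"
          by (intro principal_eigenvalue_antimono) auto
        with a ge show "a < principal_eigenvalue F f (ball 0 1 - cball 0 \<delta>)" by order
      qed
    next
      fix a assume "ereal \<mu> < a"
      then obtain \<nu> where \<nu>: "\<mu> < \<nu>" "ereal \<nu> < a" using ereal_dense2 by force
      obtain \<delta> \<rho> where *: "0 < \<delta>" "\<rho> < 1" "\<And>\<Omega> h \<nu>'. {x. \<delta> \<le> norm x \<and> norm x \<le> \<rho>} \<subseteq> \<Omega> \<Longrightarrow>
        (\<forall>x. \<delta> < norm x \<longrightarrow> norm x < \<rho> \<longrightarrow> 0 \<le> h x \<and> \<nu> * f x \<le> \<nu>' * h x) \<Longrightarrow>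
        principal_eigenvalue F h \<Omega> \<le> ereal \<nu>'"
        using upper[OF \<nu>(1)] by auto
      \<comment> \<open>Once d < \<delta>, the fixed annulus lies in the perforated ball.\<close>
      have "\<forall>\<^sub>F d in at_right (0::real). d \<in> {0<..<\<delta>}" using *(1) by (rule eventually_at_right_real)
      then show "\<forall>\<^sub>F d in at_right 0. principal_eigenvalue F f (ball 0 1 - cball 0 d) < a"
      proof eventually_elim
        fix d assume "d \<in> {0<..<\<delta>}"
        then have "principal_eigenvalue F f (ball 0 1 - cball 0 d) \<le> ereal \<nu>"
          using *(2) by (intro *(3)) (auto simp: f_def)
        then show "principal_eigenvalue F f (ball 0 1 - cball 0 d) < a"
          using \<nu>(2) by (rule le_less_trans)
      qed
    qed
    have "\<exists>L. L-lipschitz_on (ball 0 1) u" if "\<gamma> \<le> 1"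
      unfolding u_def using radial_lipschitz[of C "2 - \<gamma>" p] C that lip by force
    moreover have "C1_on (ball 0 1) u" if "\<gamma> < 1"
      unfolding u_def
      by (rule radial_C1[of C "2 - \<gamma>", OF _ _ C2[unfolded u_def g_def]])
        (use C that lip p1b in auto)
    moreover have "holder_on (2 - \<gamma>) (ball 0 1) u" if "\<gamma> > 1"
      unfolding u_def by (rule radial_holder[of C]) (use C that \<gamma> lip in auto)
    moreover have "viscosity_solution F (\<lambda>x. \<mu> * f x) (ball 0 1 - {0}) u"
      using sup sub uc unfolding viscosity_solution_def
      by (auto intro: continuous_on_subset[OF uc])
    moreover have "C2_on (ball 0 1 - {0}) u" using C2' unfolding C2_on_def by blast
    moreover have "\<exists>v. \<forall>x\<in>cball 0 1. u x = v (norm x)" by (auto simp: u_def)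
    moreover have "\<forall>x\<in>sphere 0 1. u x = 0" by (simp add: u_def p_1)
    ultimately have "\<exists>u. (\<exists>v. \<forall>x\<in>cball 0 1. u x = v (norm x)) \<and> continuous_on (cball 0 1) u \<and>
        (\<forall>x\<in>ball 0 1. 0 < u x) \<and> viscosity_solution F (\<lambda>x. \<mu> * f x) (ball 0 1 - {0}) u \<and>
        (\<forall>x\<in>sphere 0 1. u x = 0) \<and> C2_on (ball 0 1 - {0}) u \<and>
        (\<gamma> \<le> 1 \<longrightarrow> (\<exists>L. L-lipschitz_on (ball 0 1) u)) \<and> (\<gamma> < 1 \<longrightarrow> C1_on (ball 0 1) u) \<and>
        (\<gamma> > 1 \<longrightarrow> holder_on (2 - \<gamma>) (ball 0 1) u)"
      using uc upos by blast
    then show ?thesis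
      using lim1 lim2 \<mu> unfolding sing f_def f'_def by blast
  qed
qed

end
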